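(* Let $s,t\in\mathbb{N}$ and let $\mathscr{P}$ be a biclique-profile with start-index $s$ and start value $\mathscr{P}_s=t-1$ as well as non-negative limit. There exist $\alpha\in\mathbb{Q}_{\ge 0}$, $R,N_{s,t}\in\mathbb{N}$, and graphs (core graphs) $G_0,\dots,G_{R-1}$, each of size at most $N_{s,t}$, with designated components $H_j\subseteq G_j$ such that any vertex in $H_j$ has exactly the same neighbourhood outside of $H_j$, such that for $n$ large enough there is a $\mathscr{P}$-extremal cograph on $n$ vertices obtained by pumping $H_{(n\bmod R)}$ inside of $G_{(n\bmod R)}$. There are constants $a_0,\dots,a_{R-1}\in\mathbb{Q}_{\le 0}$ such that for large $n$ $$\mathrm{ex}(n,\{\mathscr{P},P_4\text{-ind}\})=a_{(n\bmod R)}+\alpha n .$$ Moreover, $\alpha\le s-1+\frac{t-1}{2}$, and in case $s\ge 2$ we have the upper bound $$\mathrm{ex}(n,\{\mathscr{P},P_4\text{-ind}\})<\left(s-1+\frac{t-1}{2}\right)\cdot n\quad\text{for any } n\in\mathbb{N}.$$ In case that $H_q$ is a connectivity component in $G_q$ for some $q\in\mathbb{Z}/R\mathbb{Z}$, we have $\alpha<s-1+\frac{t-1}{2}$.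
   Context: Graphs are finite and simple; $\mathbb{N}=\{1,2,\dots\}$, $\mathbb{N}_0=\{0,1,2,\dots\}$; $n\bmod R\in\{0,\dots,R-1\}$; the size of a graph is its number of vertices. A cograph is a graph with no induced path $P_4$ on four vertices. $K_{s,t}$ is the complete bipartite graph with parts of sizes $s,t$, with $K_{0,t}$ the edgeless graph on $t$ vertices; $K_{s,t}\subseteq G$ means containment as a (not necessarily induced) subgraph. The biclique-sequence of $G$ is $\mathscr{S}(G)=(\mathscr{S}_s(G))_{s\in\mathbb{N}_0}$ with $\mathscr{S}_s(G)=\max\{t\in\mathbb{N}_0 : K_{s,t}\subseteq G\}$, where the maximum of the empty set is $-\infty$. A biclique-profile is a sequence $\mathscr{P}=(\mathscr{P}_j)_{j\in\mathbb{N}_0}$ with values in $\mathbb{N}_0\cup\{\infty,-\infty\}$ that is (weakly) decreasing and subdiagonal, i.e. $\mathscr{P}_j<l\implies\mathscr{P}_l<j$ for all $j,l\in\mathbb{N}_0$. A graph $G$ fulfills $\mathscr{P}$ if $\mathscr{S}_j(G)\le\mathscr{P}_j$ for all $j$. A cograph is $\mathscr{P}$-extremal if it fulfills $\mathscr{P}$ and has the maximum number of edges among all cographs with the same number of vertices that fulfill $\mathscr{P}$; $\mathrm{ex}(n,\{\mathscr{P},P_4\text{-ind}\})$ denotes the number of edges of the $\mathscr{P}$-extremal cographs on $n$ vertices. The start-index of $\mathscr{P}$ is the minimal $i\in\mathbb{N}_0$ with $\mathscr{P}_i<\infty$. Non-negative limit means $\lim_{j\to\infty}\mathscr{P}_j\ge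 0$. A designated component $H_j$ of $G_j$ is a nonempty induced subgraph (not necessarily a connected component); a connectivity component is a connected component in the usual sense. Pumping: let $G$ be a graph and $H\subseteq G$ a subgraph. Pumping $H$ in $G$ $k$ times gives the graph $G'$ defined as follows: with $H_1,\dots,H_{k+1}$ disjoint copies of $H$, $V(G')=(V(G)\setminus V(H))\cup\bigcup_{j=1}^{k+1}V(H_j)$, and the edges of $G'$ are the edges of $G-V(H)$, the edges of each $H_j$, and all edges $v'w$ with $v'\in V(H_j)$ the copy of $v\in V(H)$ and $w\in V(G)\setminus V(H)$ a neighbour of $v$ in $G$. A graph is obtained by pumping $H$ inside $G$ if it arises by pumping $H$ in $G$ $k$ times for some $k$. *)

theory Defs
  imports Complex_Main "HOL-Library.Extended_Real"
begin

record 'a ugraph =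
  verts :: "'a set"
  edges :: "'a set set"

definition simple_graph :: "'a ugraph \<Rightarrow> bool" where
  "simple_graph G \<longleftrightarrow> finite (verts G) \<and> (\<forall>e\<in>edges G. e \<subseteq> verts G \<and> card e = 2)"

definition adj :: "'a ugraph \<Rightarrow> 'a \<Rightarrow> 'a \<Rightarrow> bool" where
  "adj G u v \<longleftrightarrow> {u, v} \<in> edges G"

definition nbhd :: "'a ugraph \<Rightarrow> 'a \<Rightarrow> 'a set" where
  "nbhd G v = {w \<in> verts G. adj G v w}"

definition subgraph :: "'a ugraph \<Rightarrow> 'a ugraph \<Rightarrow> bool" where
  "subgraph H G \<longleftrightarrow> simple_graph H \<and> verts H \<subseteq> verts G \<and> edges H \<subseteq> edges G"

definition induced_subgraph :: "'a ugraph \<Rightarrow> 'a ugraph \<Rightarrow> bool" where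
  "induced_subgraph H G \<longleftrightarrow>
     subgraph H G \<and> edges H = {e \<in> edges G. e \<subseteq> verts H}"

definition contains_copy :: "'b ugraph \<Rightarrow> 'a ugraph \<Rightarrow> bool" where
  "contains_copy F G \<longleftrightarrow>
     (\<exists>f. inj_on f (verts F) \<and> f ` verts F \<subseteq> verts G \<and>
          (\<forall>u\<in>verts F. \<forall>v\<in>verts F. adj F u v \<longrightarrow> adj G (f u) (f v)))"

definition contains_induced_copy :: "'b ugraph \<Rightarrow> 'a ugraph \<Rightarrow> bool" where
  "contains_induced_copy F G \<longleftrightarrow>
     (\<exists>f. inj_on f (verts F) \<and> f ` verts F \<subseteq> verts G \<and>
          (\<forall>u\<in>verts F. \<forall>v\<in>verts F. adj F u v \<longleftrightarrow> adj G (f u) (f v)))"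

definition connectivity_component :: "'a ugraph \<Rightarrow> 'a ugraph \<Rightarrow> bool" where
  "connectivity_component H G \<longleftrightarrow>
     induced_subgraph H G \<and> (\<exists>u\<in>verts G. verts H = {v \<in> verts G. (adj G)\<^sup>*\<^sup>* u v})"

definition path_graph :: "nat \<Rightarrow> nat ugraph" where
  "path_graph n = \<lparr>verts = {..<n}, edges = {{i, Suc i} | i. Suc i < n}\<rparr>"

definition cograph :: "'a ugraph \<Rightarrow> bool" where
  "cograph G \<longleftrightarrow> simple_graph G \<and> \<not> contains_induced_copy (path_graph 4) G"

definition complete_bipartite :: "nat \<Rightarrow> nat \<Rightarrow> nat ugraph" where
  "complete_bipartite s t =
     \<lparr>verts = {..<s + t}, edges = {{u, v} | u v. u < s \<and> s \<le> v \<and> v < s + t}\<rparr>"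

text \<open>For a finite graph the supremum below ranges over a finite set, so it is a maximum unless
  the set is empty, in which case it is \<open>-\<infinity>\<close>.\<close>

definition biclique_seq :: "'a ugraph \<Rightarrow> nat \<Rightarrow> ereal" where
  "biclique_seq G s =
     (SUP t \<in> {t. contains_copy (complete_bipartite s t) G}. ereal (real t))"

definition biclique_profile :: "(nat \<Rightarrow> ereal) \<Rightarrow> bool" where
  "biclique_profile P \<longleftrightarrow>
     range P \<subseteq> range (\<lambda>m::nat. ereal (real m)) \<union> {\<infinity>, -\<infinity>} \<and>
     decseq P \<and>
     (\<forall>j l. P j < ereal (real l) \<longrightarrow> P l < ereal (real j))"

text \<open>Only meaningful if some value of the profile is less than \<open>\<infinity>\<close>.\<close>

definition start_index :: "(nat \<Rightarrow> ereal) \<Rightarrow> nat" where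
  "start_index P = (LEAST i. P i < \<infinity>)"

definition fulfills :: "'a ugraph \<Rightarrow> (nat \<Rightarrow> ereal) \<Rightarrow> bool" where
  "fulfills G P \<longleftrightarrow> (\<forall>j. biclique_seq G j \<le> P j)"

text \<open>Up to isomorphism every finite graph has vertices in \<^typ>\<open>nat\<close>, so it suffices
  to compare with those.\<close>

definition extremal_cograph :: "(nat \<Rightarrow> ereal) \<Rightarrow> 'a ugraph \<Rightarrow> bool" where
  "extremal_cograph P G \<longleftrightarrow>
     cograph G \<and> fulfills G P \<and>
     (\<forall>G' :: nat ugraph. cograph G' \<and> fulfills G' P \<and> card (verts G') = card (verts G) \<longrightarrow>
        card (edges G') \<le> card (edges G))"

definition ex_cograph :: "nat \<Rightarrow> (nat \<Rightarrow> ereal) \<Rightarrow> nat" where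
  "ex_cograph n P =
     Max {card (edges G) | G :: nat ugraph. cograph G \<and> fulfills G P \<and> card (verts G) = n}"

text \<open>A vertex \<open>v\<close> outside of \<open>H\<close> is represented by \<open>(v, 0)\<close>, and the copy of a vertex
  \<open>v\<close> of \<open>H\<close> in the \<open>i\<close>-th of the \<open>k + 1\<close> copies of \<open>H\<close> by \<open>(v, i)\<close> with \<open>1 \<le> i \<le> k + 1\<close>.\<close>

definition pump :: "'a ugraph \<Rightarrow> 'a ugraph \<Rightarrow> nat \<Rightarrow> ('a \<times> nat) ugraph" where
  "pump G H k =
     \<lparr>verts = (verts G - verts H) \<times> {0} \<union> verts H \<times> {1..k + 1},
      edges =
        {{(u, 0), (v, 0)} | u v. u \<in> verts G - verts H \<and> v \<in> verts G - verts H \<and> adj G u v} \<union>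
        {{(u, i), (v, i)} | u v i. i \<in> {1..k + 1} \<and> adj H u v} \<union>
        {{(v, i), (w, 0)} | v w i. i \<in> {1..k + 1} \<and>
             v \<in> verts H \<and> w \<in> verts G - verts H \<and> adj G v w}\<rparr>"

definition designated_component :: "'a ugraph \<Rightarrow> 'a ugraph \<Rightarrow> bool" where
  "designated_component H G \<longleftrightarrow> induced_subgraph H G \<and> verts H \<noteq> {}"

definition same_outer_nbhd :: "'a ugraph \<Rightarrow> 'a ugraph \<Rightarrow> bool" where
  "same_outer_nbhd H G \<longleftrightarrow>
     (\<forall>u\<in>verts H. \<forall>v\<in>verts H. nbhd G u - verts H = nbhd G v - verts H)"

end

theory Submission
  imports Defs
begin

text \<open>Call a nonempty vertex set \<open>M\<close> of an admissible cograph a piece if all its vertices have the same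
  neighbourhood \<open>A\<close> outside of \<open>M\<close>, and \<open>|A| \<le> s - 1\<close>. Pumping a piece never creates a biclique with
  both sides of size at least \<open>s\<close>, hence preserves admissibility, and each copy adds
  \<open>e(M) + |A| |M|\<close> edges. Let the density of the piece be this number divided by \<open>|M|\<close>, and let \<open>\<alpha>\<close> be
  the maximal density of the finitely many kinds of pieces with at most \<open>2 t\<close> vertices.
  Decomposing a cograph recursively by unions and joins shows that a bound \<open>c \<ge> s - 2\<close> for the densities
  of its small pieces bounds the number of its edges by \<open>c n\<close>. So \<open>ex(n) \<le> \<alpha> n\<close>, and every graph
  without a small piece of density exactly \<open>\<alpha>\<close> has at most \<open>\<beta> n\<close> edges for some fixed \<open>\<beta> < \<alpha>\<close>. Since pumping a
  densest piece gives \<open>ex(n) \<ge> \<alpha> n - O(1)\<close>, all large extremal graphs contain a small piece of density \<open>\<alpha>\<close>.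
  Pumping this piece in a graph that minimises the deficit \<open>\<alpha> n - ex(n)\<close> within its residue class (the
  deficits are nonnegative with bounded denominator) keeps the deficit and yields all large extremal
  graphs of the class.\<close>

definition arcs :: "('a \<Rightarrow> 'a \<Rightarrow> bool) \<Rightarrow> 'a set \<Rightarrow> nat" where
  "arcs E M = (\<Sum>x\<in>M. \<Sum>y\<in>M. of_bool (E x y))"

lemma arcs_union:
  assumes "symp E" "finite X" "finite Y" "X \<inter> Y = {}"
  shows "arcs E (X \<union> Y) = arcs E X + arcs E Y + 2 * (\<Sum>x\<in>X. \<Sum>y\<in>Y. of_bool (E x y))"
proof -
  have "(\<Sum>y\<in>Y. \<Sum>x\<in>X. of_bool (E y x)) = (\<Sum>x\<in>X. \<Sum>y\<in>Y. of_bool (E x y) :: nat)"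
    using assms(1) by (subst sum.swap) (auto intro!: sum.cong dest: sympD)
  then show ?thesis
    using assms by (simp add: arcs_def sum.union_disjoint sum.distrib del: sum_of_bool_eq)
qed

lemma arcs_union_module:
  assumes "symp E" "finite X" "finite Y" "X \<inter> Y = {}" "C \<subseteq> X" "\<forall>x\<in>X. \<forall>y\<in>Y. E x y \<longleftrightarrow> x \<in> C"
  shows "arcs E (X \<union> Y) = arcs E X + arcs E Y + 2 * card C * card Y"
proof -
  have "(\<Sum>x\<in>X. \<Sum>y\<in>Y. of_bool (E x y)) = (\<Sum>x\<in>X. of_bool (x \<in> C) * card Y)"
    using assms(6) by (intro sum.cong) auto
  also have "\<dots> = card C * card Y"
    using assms(2,5) by (simp add: Int_absorb1 flip: sum_distrib_right)
  finally show ?thesis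
    using arcs_union[OF assms(1-4)] by simp
qed

lemma arcs_union_anticomplete:
  assumes "symp E" "finite X" "finite Y" "X \<inter> Y = {}" "\<forall>x\<in>X. \<forall>y\<in>Y. \<not> E x y"
  shows "arcs E (X \<union> Y) = arcs E X + arcs E Y"
  using arcs_union[OF assms(1-4)] assms(5) by simp

lemma arcs_union_complete:
  assumes "symp E" "finite X" "finite Y" "X \<inter> Y = {}" "\<forall>x\<in>X. \<forall>y\<in>Y. E x y"
  shows "arcs E (X \<union> Y) = arcs E X + arcs E Y + 2 * card X * card Y"
  using arcs_union[OF assms(1-4)] assms(5) by simp

lemma arcs_le:
  assumes "irreflp E" "finite X"
  shows "arcs E X \<le> card X * (card X - 1)"
proof -
  have "(\<Sum>y\<in>X. of_bool (E x y)) \<le> card X - 1" if "x \<in> X" for x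
  proof -
    have "(\<Sum>y\<in>X. of_bool (E x y) :: nat) \<le> (\<Sum>y\<in>X. of_bool (y \<noteq> x))"
      using assms(1) by (intro sum_mono) (auto dest: irreflpD)
    also have "\<dots> = card (X - {x})"
      using assms(2) by (simp add: sum.If_cases of_bool_def Int_def set_diff_eq)
    finally show ?thesis
      using that assms(2) by simp
  qed
  then show ?thesis
    unfolding arcs_def
    using sum_bounded_above[of X "\<lambda>x. \<Sum>y\<in>X. of_bool (E x y)" "card X - 1"] by (simp del: sum_of_bool_eq)
qed

lemma arcs_image:
  assumes "inj_on f M" "\<And>x y. x \<in> M \<Longrightarrow> y \<in> M \<Longrightarrow> E' (f x) (f y) \<longleftrightarrow> E x y"
  shows "arcs E' (f ` M) = arcs E M"
  using assms by (simp add: arcs_def sum.reindex del: sum_of_bool_eq)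

section \<open>Cographs and bicliques\<close>

definition P4_free :: "('a \<Rightarrow> 'a \<Rightarrow> bool) \<Rightarrow> 'a set \<Rightarrow> bool" where
  "P4_free E M \<longleftrightarrow>
     (\<forall>a\<in>M. \<forall>b\<in>M. \<forall>c\<in>M. \<forall>d\<in>M. distinct [a, b, c, d] \<longrightarrow>
        E a b \<longrightarrow> E b c \<longrightarrow> E c d \<longrightarrow> E a c \<or> E a d \<or> E b d)"

lemma not_P4_freeE:
  assumes "\<not> P4_free E M"
  obtains a b c d where "{a, b, c, d} \<subseteq> M" "distinct [a, b, c, d]"
    "E a b" "E b c" "E c d" "\<not> E a c" "\<not> E a d" "\<not> E b d"
  using assms unfolding P4_free_def by auto

lemma P4_free_subset: "P4_free E M \<Longrightarrow> M' \<subseteq> M \<Longrightarrow> P4_free E M'"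
  unfolding P4_free_def by (meson subsetD)

text \<open>The path \<open>b d a c\<close> is the complement of the path \<open>a b c d\<close>.\<close>

lemma P4_free_compl:
  assumes "symp E" "P4_free E M"
  shows "P4_free (\<lambda>x y. \<not> E x y) M"
  unfolding P4_free_def
proof (intro ballI impI)
  fix a b c d
  assume *: "a \<in> M" "b \<in> M" "c \<in> M" "d \<in> M" "distinct [a, b, c, d]"
    "\<not> E a b" "\<not> E b c" "\<not> E c d"
  have "E c a \<longrightarrow> E a d \<longrightarrow> E d b \<longrightarrow> E c d \<or> E c b \<or> E a b"
    using assms(2)[unfolded P4_free_def, rule_format, OF *(3,1,4,2)] *(5) by auto
  moreover have "E x y \<longleftrightarrow> E y x" for x y
    using assms(1) by (auto dest: sympD)
  ultimately show "\<not> E a c \<or> \<not> E a d \<or> \<not> E b d"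
    using *(6-8) by blast
qed

definition homogeneous_split :: "('a \<Rightarrow> 'a \<Rightarrow> bool) \<Rightarrow> 'a set \<Rightarrow> 'a set \<Rightarrow> 'a set \<Rightarrow> bool" where
  "homogeneous_split E M X Y \<longleftrightarrow>
     X \<union> Y = M \<and> X \<inter> Y = {} \<and> X \<noteq> {} \<and> Y \<noteq> {} \<and>
     ((\<forall>x\<in>X. \<forall>y\<in>Y. E x y) \<or> (\<forall>x\<in>X. \<forall>y\<in>Y. \<not> E x y))"

lemma homogeneous_split_compl:
  "homogeneous_split (\<lambda>x y. \<not> E x y) M X Y \<longleftrightarrow> homogeneous_split E M X Y"
  unfolding homogeneous_split_def by auto

lemma homogeneous_split_sym:
  "symp E \<Longrightarrow> homogeneous_split E M X Y \<Longrightarrow> homogeneous_split E M Y X"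
  unfolding homogeneous_split_def by (auto dest: sympD)

lemma homogeneous_split_insert:
  assumes E: "symp E" "P4_free E (insert v M)" and v: "v \<notin> M"
    and XY: "X \<union> Y = M" "X \<inter> Y = {}" "X \<noteq> {}" "Y \<noteq> {}" "\<forall>x\<in>X. \<forall>y\<in>Y. \<not> E x y"
  shows "\<exists>X Y. homogeneous_split E (insert v M) X Y"
proof (cases "\<exists>w\<in>M. \<exists>z\<in>M. E v w \<and> \<not> E v z \<and> E w z")
  case True
  then obtain w z where wz: "w \<in> M" "z \<in> M" "E v w" "\<not> E v z" "E w z"
    by blast
  have no_P4: "\<not> E v u" if "u \<in> M" "\<not> E u w" "\<not> E u z" for u
  proof
    assume "E v u"
    then have "distinct [u, v, w, z]"
      using that wz v E(1) by (auto dest: sympD)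
    then show False
      using E(2) that wz \<open>E v u\<close> E(1) unfolding P4_free_def by (metis insertCI sympD)
  qed
  have sym: "\<forall>x\<in>X. \<forall>y\<in>Y. \<not> E y x"
    using XY(5) E(1) by (auto dest: sympD)
  have "{w, z} \<subseteq> X \<or> {w, z} \<subseteq> Y"
    using wz XY(1,5) sym by auto
  then show ?thesis
  proof
    assume "{w, z} \<subseteq> X"
    then have "\<forall>y\<in>Y. \<not> E v y"
      using no_P4 XY(1) sym by blast
    then have "homogeneous_split E (insert v M) (insert v X) Y"
      using XY v unfolding homogeneous_split_def by auto
    then show ?thesis by blast
  next
    assume "{w, z} \<subseteq> Y"
    then have "\<forall>x\<in>X. \<not> E v x"
      using no_P4 XY(1,5) by blast
    then have "homogeneous_split E (insert v M) (insert v Y) X"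
      using XY v sym unfolding homogeneous_split_def by auto
    then show ?thesis by blast
  qed
next
  case False
  show ?thesis
  proof (cases "\<forall>z\<in>M. E v z")
    case True
    then have "homogeneous_split E (insert v M) {v} M"
      using XY v unfolding homogeneous_split_def by auto
    then show ?thesis by blast
  next
    case not_all: False
    then have "homogeneous_split E (insert v M) (insert v {w\<in>M. E v w}) {z\<in>M. \<not> E v z}"
      using False v unfolding homogeneous_split_def by auto
    then show ?thesis by blast
  qed
qed

lemma cograph_split:
  assumes "symp E" "finite M" "P4_free E M" "card M \<ge> 2"
  shows "\<exists>X Y. homogeneous_split E M X Y"
  using assms(2-4)
proof (induction M rule: finite_induct)
  case empty
  then show ?case by simp
next
  case (insert v M)
  show ?case
  proof (cases "card M \<ge> 2")
    case False
    then have "card M = 1"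
      using insert by simp
    then obtain w where "M = {w}"
      by (rule card_1_singletonE)
    then have "homogeneous_split E (insert v M) {v} {w}"
      using insert.hyps unfolding homogeneous_split_def by auto
    then show ?thesis by blast
  next
    case True
    then obtain X Y where XY: "homogeneous_split E M X Y"
      using insert P4_free_subset[OF insert.prems(1)] by blast
    then consider "\<forall>x\<in>X. \<forall>y\<in>Y. E x y" | "\<forall>x\<in>X. \<forall>y\<in>Y. \<not> E x y"
      unfolding homogeneous_split_def by blast
    then show ?thesis
    proof cases
      case 1
      then have "\<exists>X Y. homogeneous_split (\<lambda>x y. \<not> E x y) (insert v M) X Y"
        using XY insert.hyps(2) assms(1)
        by (intro homogeneous_split_insert[OF _ P4_free_compl[OF assms(1) insert.prems(1)], of X Y])
          (auto simp: symp_def homogeneous_split_def)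
      then show ?thesis
        by (simp add: homogeneous_split_compl)
    next
      case 2
      then show ?thesis
        using homogeneous_split_insert[OF assms(1) insert.prems(1) insert.hyps(2), of X Y] XY
        unfolding homogeneous_split_def by auto
    qed
  qed
qed

definition biclique :: "('a \<Rightarrow> 'a \<Rightarrow> bool) \<Rightarrow> 'a set \<Rightarrow> nat \<Rightarrow> nat \<Rightarrow> bool" where
  "biclique E M j l \<longleftrightarrow>
     (\<exists>X Y. X \<subseteq> M \<and> Y \<subseteq> M \<and> X \<inter> Y = {} \<and> card X = j \<and> card Y = l \<and> (\<forall>x\<in>X. \<forall>y\<in>Y. E x y))"

lemma biclique_mono: "biclique E M j l \<Longrightarrow> M \<subseteq> M' \<Longrightarrow> biclique E M' j l"
  unfolding biclique_def by (elim exE conjE, intro exI conjI) auto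

lemma bicliqueI_ge:
  assumes "X \<subseteq> M" "Y \<subseteq> M" "X \<inter> Y = {}" "j \<le> card X" "l \<le> card Y" "\<forall>x\<in>X. \<forall>y\<in>Y. E x y"
  shows "biclique E M j l"
proof -
  obtain X' where X': "X' \<subseteq> X" "card X' = j"
    using assms(4) by (rule obtain_subset_with_card_n)
  obtain Y' where Y': "Y' \<subseteq> Y" "card Y' = l"
    using assms(5) by (rule obtain_subset_with_card_n)
  show ?thesis
    unfolding biclique_def
    by (rule exI[of _ X'], rule exI[of _ Y']) (use assms X' Y' in blast)
qed

lemma biclique_join_left:
  assumes "biclique E Y j l" "finite A" "finite Y" "A \<inter> Y = {}" "\<forall>a\<in>A. \<forall>y\<in>Y. E a y"
  shows "biclique E (A \<union> Y) (card A + j) l"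
proof -
  obtain U W where UW: "U \<subseteq> Y" "W \<subseteq> Y" "U \<inter> W = {}" "card U = j" "card W = l" "\<forall>x\<in>U. \<forall>y\<in>W. E x y"
    using assms(1) unfolding biclique_def by auto
  have "finite U"
    using UW(1) assms(3) finite_subset by blast
  moreover have "A \<inter> U = {}"
    using UW(1) assms(4) by blast
  ultimately have "card (A \<union> U) = card A + j"
    using UW(4) assms(2) by (simp add: card_Un_disjoint)
  then show ?thesis
    unfolding biclique_def
    by (intro exI[of _ "A \<union> U"] exI[of _ W]) (use UW assms(4,5) in auto)
qed

lemma biclique_sym: "symp E \<Longrightarrow> biclique E M j l \<Longrightarrow> biclique E M l j"
  unfolding biclique_def
  by (elim exE conjE, rule_tac x = Y in exI, rule_tac x = X in exI) (blast dest: sympD)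

lemma biclique_join_right:
  assumes "symp E" "biclique E Y j l" "finite A" "finite Y" "A \<inter> Y = {}" "\<forall>a\<in>A. \<forall>y\<in>Y. E a y"
  shows "biclique E (A \<union> Y) j (card A + l)"
  using assms biclique_join_left biclique_sym by metis

lemma ordered_split:
  assumes "symp E" "finite M" "P4_free E M" "card M \<ge> 2"
  obtains X Y where "homogeneous_split E M X Y" "card X \<le> card Y"
    "finite X" "finite Y" "card X > 0" "card M = card X + card Y"
proof -
  obtain X Y where "homogeneous_split E M X Y"
    using cograph_split[OF assms] by blast
  then obtain X Y where XY: "homogeneous_split E M X Y" "card X \<le> card Y"
    using homogeneous_split_sym[OF assms(1)] by (metis nle_le)
  then have "finite X" "finite Y" "X \<noteq> {}" "M = X \<union> Y" "X \<inter> Y = {}"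
    using assms(2) unfolding homogeneous_split_def by auto
  then show thesis
    using that[OF XY] by (simp add: card_Un_disjoint card_gt_0_iff)
qed

text \<open>If \<open>M\<close> is the join of \<open>X\<close> and \<open>Y\<close> with \<open>p < card X \<le> card Y\<close>, then \<open>card Y \<le> q\<close>, and the parts exclude
  the bicliques with \<open>q\<close> lowered by the size of the other part. The induction hypothesis for these values
  exactly makes up for the \<open>card X * card Y\<close> edges of the join.\<close>

lemma arcs_biclique_free:
  assumes "symp E" "irreflp E" "finite M" "P4_free E M" "\<not> biclique E M (Suc p) (Suc q)"
  shows "arcs E M \<le> (2 * p + q) * card M"
    and "p \<ge> 1 \<Longrightarrow> M \<noteq> {} \<Longrightarrow> arcs E M < (2 * p + q) * card M"
proof -
  have "arcs E M \<le> (2 * p + q) * card M \<and> (p \<ge> 1 \<longrightarrow> M \<noteq> {} \<longrightarrow> arcs E M < (2 * p + q) * card M)"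
    using assms(3-5)
  proof (induction "card M" arbitrary: M p q rule: less_induct)
    case (less M)
    show ?case
    proof (cases "card M \<ge> 2")
      case False
      then have "arcs E M = 0"
        using arcs_le[OF assms(2) less.prems(1)]
        by (metis Suc_1 diff_is_0_eq less_Suc_eq_le le_zero_eq mult_is_0 not_le)
      then show ?thesis
        using less.prems(1) by (auto simp: card_gt_0_iff)
    next
      case True
      then obtain X Y where XY: "homogeneous_split E M X Y" "card X \<le> card Y"
        and fin: "finite X" "finite Y" and pos: "card X > 0" and card_M: "card M = card X + card Y"
        using ordered_split[OF assms(1) less.prems(1,2)] by blast
      have sub: "M = X \<union> Y" "X \<inter> Y = {}" "X \<subseteq> M" "Y \<subseteq> M" "X \<noteq> {}" "Y \<noteq> {}"
        using XY(1) unfolding homogeneous_split_def by auto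
      have lt: "card X < card M" "card Y < card M"
        using card_M pos XY(2) by auto
      note P4 = P4_free_subset[OF less.prems(2) sub(3)] P4_free_subset[OF less.prems(2) sub(4)]
      consider (none) "\<forall>x\<in>X. \<forall>y\<in>Y. \<not> E x y" | (join) "\<forall>x\<in>X. \<forall>y\<in>Y. E x y"
        using XY(1) unfolding homogeneous_split_def by auto
      then show ?thesis
      proof cases
        case none
        have "\<not> biclique E X (Suc p) (Suc q)" "\<not> biclique E Y (Suc p) (Suc q)"
          using less.prems(3) sub biclique_mono by blast+
        then have "arcs E X \<le> (2 * p + q) * card X \<and> (p \<ge> 1 \<longrightarrow> arcs E X < (2 * p + q) * card X)"
          "arcs E Y \<le> (2 * p + q) * card Y \<and> (p \<ge> 1 \<longrightarrow> arcs E Y < (2 * p + q) * card Y)"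
          using less.hyps[OF lt(1) fin(1) P4(1)] less.hyps[OF lt(2) fin(2) P4(2)] sub by auto
        then show ?thesis
          using arcs_union_anticomplete[OF assms(1) fin sub(2) none] sub(1) card_M
          by (auto simp: distrib_left)
      next
        case join
        have arcs_M: "arcs E M = arcs E X + arcs E Y + 2 * card X * card Y"
          using arcs_union_complete[OF assms(1) fin sub(2) join] sub(1) by simp
        show ?thesis
        proof (cases "card X \<le> p")
          case True
          have "biclique E M (Suc p) (Suc q)" if "biclique E Y (Suc (p - card X)) (Suc q)"
            using biclique_join_left[OF that fin sub(2) join] sub(1) True by simp
          then have "arcs E Y \<le> (2 * (p - card X) + q) * card Y"
            using less.hyps[OF lt(2) fin(2) P4(2)] less.prems(3) by blast
          moreover have "(2 * (p - card X) + q) * card Y + 2 * card X * card Y = (2 * p + q) * card Y"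
            using True by (simp add: diff_mult_distrib2 algebra_simps flip: distrib_left)
          moreover have "arcs E X < (2 * p + q) * card X"
          proof -
            have "card X * (card X - 1) < card X * (2 * p + q)"
              using True pos by simp
            then show ?thesis
              using arcs_le[OF assms(2) fin(1)] by (metis le_less_trans mult.commute)
          qed
          ultimately show ?thesis
            using arcs_M card_M by (auto simp: distrib_left)
        next
          case False
          have "card Y \<le> q"
          proof (rule ccontr)
            assume "\<not> card Y \<le> q"
            then have "biclique E M (Suc p) (Suc q)"
              using False join sub by (intro bicliqueI_ge[of X _ Y]) auto
            then show False
              using less.prems(3) by simp
          qed
          have join': "\<forall>y\<in>Y. \<forall>x\<in>X. E y x"
            using join assms(1) by (auto dest: sympD)
          have "biclique E M (Suc p) (Suc q)" if "biclique E X (Suc p) (Suc (q - card Y))"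
            using biclique_join_right[OF assms(1) that fin(2,1) _ join'] sub \<open>card Y \<le> q\<close>
            by (simp add: Un_commute Int_commute)
          then have X: "arcs E X \<le> (2 * p + (q - card Y)) * card X"
              "p \<ge> 1 \<longrightarrow> arcs E X < (2 * p + (q - card Y)) * card X"
            using less.hyps[OF lt(1) fin(1) P4(1)] less.prems(3) sub by blast+
          have "biclique E M (Suc p) (Suc q)" if "biclique E Y (Suc p) (Suc (q - card X))"
            using biclique_join_right[OF assms(1) that fin _ join] sub \<open>card Y \<le> q\<close> XY(2)
            by simp
          then have Y: "arcs E Y \<le> (2 * p + (q - card X)) * card Y"
            using less.hyps[OF lt(2) fin(2) P4(2)] less.prems(3) by blast
          obtain k where k: "q = k + card Y"
            using \<open>card Y \<le> q\<close> by (metis le_add_diff_inverse2)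
          obtain m where m: "q = m + card X"
            using \<open>card Y \<le> q\<close> XY(2) by (metis le_add_diff_inverse2 order_trans)
          have "(2 * p + (q - card Y)) * card X + (2 * p + (q - card X)) * card Y + 2 * card X * card Y
            = (2 * p + q) * card M"
          proof -
            have "(2 * p + (q - card Y)) * card X + card X * card Y = (2 * p + q) * card X"
              unfolding k by (simp add: algebra_simps)
            moreover have "(2 * p + (q - card X)) * card Y + card X * card Y = (2 * p + q) * card Y"
              unfolding m by (simp add: algebra_simps)
            ultimately show ?thesis
              unfolding card_M by (simp add: distrib_left)
          qed
          then show ?thesis
            using X Y arcs_M by auto
        qed
      qed
    qed
  qed
  then show "arcs E M \<le> (2 * p + q) * card M"
    and "p \<ge> 1 \<Longrightarrow> M \<noteq> {} \<Longrightarrow> arcs E M < (2 * p + q) * card M"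
    by auto
qed

section \<open>Pieces\<close>

definition piece :: "('a \<Rightarrow> 'a \<Rightarrow> bool) \<Rightarrow> 'a set \<Rightarrow> nat \<Rightarrow> 'a set \<Rightarrow> 'a set \<Rightarrow> bool" where
  "piece E V p M A \<longleftrightarrow>
     M \<subseteq> V \<and> M \<noteq> {} \<and> A \<subseteq> V - M \<and> card A \<le> p \<and> (\<forall>x\<in>M. \<forall>y\<in>V - M. E x y \<longleftrightarrow> y \<in> A)"

text \<open>Twice the number of edges gained by one more copy of \<open>M\<close>, since \<open>arcs\<close> counts every edge twice.\<close>

definition weight :: "('a \<Rightarrow> 'a \<Rightarrow> bool) \<Rightarrow> 'a set \<Rightarrow> 'a set \<Rightarrow> nat" where
  "weight E M A = arcs E M + 2 * card A * card M"

lemma piece_self: "V \<noteq> {} \<Longrightarrow> piece E V p V {}"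
  unfolding piece_def by auto

lemma pieceD:
  assumes "piece E V p M A"
  shows "M \<subseteq> V" "M \<noteq> {}" "A \<subseteq> V - M" "card A \<le> p" "\<forall>x\<in>M. \<forall>y\<in>V - M. E x y \<longleftrightarrow> y \<in> A"
    "\<forall>x\<in>M. \<forall>y\<in>A. E x y"
  using assms unfolding piece_def by blast+

lemma piece_finite:
  assumes "piece E V p M A" "finite V"
  shows "finite M" "finite A"
  using assms unfolding piece_def by (auto intro: finite_subset)

lemma weight_le:
  assumes "symp E" "irreflp E" "finite V" "P4_free E V" "\<not> biclique E V (Suc p) (Suc q)"
    and "piece E V p M A"
  shows "weight E M A \<le> (2 * p + q) * card M"
proof -
  have MA: "M \<subseteq> V" "A \<subseteq> V - M" "card A \<le> p" "\<forall>x\<in>M. \<forall>y\<in>A. E x y" "finite M" "finite A"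
    using pieceD[OF assms(6)] piece_finite[OF assms(6,3)] by blast+
  have "biclique E V (Suc p) (Suc q)" if "biclique E M (Suc (p - card A)) (Suc q)"
  proof -
    have "biclique E (A \<union> M) (card A + Suc (p - card A)) (Suc q)"
      using that MA assms(1) by (intro biclique_join_left) (blast dest: sympD)+
    moreover have "A \<union> M \<subseteq> V"
      using MA(1,2) by blast
    ultimately show ?thesis
      using biclique_mono MA(3) by (metis add_Suc_right le_add_diff_inverse)
  qed
  then have "arcs E M \<le> (2 * (p - card A) + q) * card M"
    using arcs_biclique_free(1)[OF assms(1,2) MA(5) P4_free_subset[OF assms(4) MA(1)]] assms(5) by blast
  then have "weight E M A \<le> (2 * (p - card A) + q + 2 * card A) * card M"
    unfolding weight_def by (simp add: algebra_simps)
  moreover have "2 * (p - card A) + q + 2 * card A = 2 * p + q"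
    using MA(3) by simp
  ultimately show ?thesis
    by simp
qed

text \<open>A large piece splits into two smaller pieces if it is disconnected. If it is the join of \<open>X\<close> and \<open>Y\<close>
  with \<open>card X \<le> card Y\<close>, then \<open>card A + card X \<le> p\<close> since there is no \<open>K\<^sub>s\<^sub>,\<^sub>t\<close>. So \<open>Y\<close> is a piece
  with outer neighbourhood \<open>A \<union> X\<close>, and \<open>X\<close> contributes at most \<open>2 p - 2\<close> per vertex.\<close>

lemma weight_le_if_small_pieces:
  fixes c :: rat
  assumes E: "symp E" "irreflp E" "finite V" "P4_free E V" "\<not> biclique E V (Suc p) (Suc q)"
    and c: "c \<ge> 2 * of_nat p - 2"
    and small: "\<And>M A. piece E V p M A \<Longrightarrow> card M \<le> 2 * Suc q \<Longrightarrow>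
      of_nat (weight E M A) \<le> c * of_nat (card M)"
    and "piece E V p M A"
  shows "of_nat (weight E M A) \<le> c * of_nat (card M)"
  using assms(8)
proof (induction "card M" arbitrary: M A rule: less_induct)
  case (less M)
  show ?case
  proof (cases "card M \<le> 2 * Suc q")
    case True
    then show ?thesis
      using small less.prems by blast
  next
    case False
    have MA: "M \<subseteq> V" "A \<subseteq> V - M" "card A \<le> p" "\<forall>x\<in>M. \<forall>y\<in>V - M. E x y \<longleftrightarrow> y \<in> A"
        "finite M" "finite A"
      using pieceD[OF less.prems] piece_finite[OF less.prems E(3)] by blast+
    obtain X Y where XY: "homogeneous_split E M X Y" "card X \<le> card Y"
      and fin: "finite X" "finite Y" and pos: "card X > 0" and card_M: "card M = card X + card Y"
      using ordered_split[OF E(1) MA(5) P4_free_subset[OF E(4) MA(1)]] False by auto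
    have sub: "M = X \<union> Y" "X \<inter> Y = {}" "X \<subseteq> M" "Y \<subseteq> M" "X \<noteq> {}" "Y \<noteq> {}"
      using XY(1) unfolding homogeneous_split_def by auto
    have lt: "card X < card M" "card Y < card M"
      using card_M pos XY(2) by auto
    consider (none) "\<forall>x\<in>X. \<forall>y\<in>Y. \<not> E x y" | (join) "\<forall>x\<in>X. \<forall>y\<in>Y. E x y"
      using XY(1) unfolding homogeneous_split_def by auto
    then show ?thesis
    proof cases
      case none
      have none': "\<forall>y\<in>Y. \<forall>x\<in>X. \<not> E y x"
        using none E(1) by (auto dest: sympD)
      have "\<forall>x\<in>X. \<forall>y\<in>V - X. E x y \<longleftrightarrow> y \<in> A" "\<forall>x\<in>Y. \<forall>y\<in>V - Y. E x y \<longleftrightarrow> y \<in> A"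
        using MA(2,4) sub(1) none none' by blast+
      then have "piece E V p X A" "piece E V p Y A"
        using MA sub unfolding piece_def by blast+
      then have "of_nat (weight E X A) \<le> c * of_nat (card X)"
        "of_nat (weight E Y A) \<le> c * of_nat (card Y)"
        using less.hyps lt by blast+
      then show ?thesis
        using arcs_union_anticomplete[OF E(1) fin sub(2) none] sub(1) card_M
        by (simp add: weight_def algebra_simps)
    next
      case join
      have "card A + card X = card (A \<union> X)"
        using MA fin sub by (subst card_Un_disjoint) auto
      have le_p: "card A + card X \<le> p"
      proof (rule ccontr)
        assume "\<not> card A + card X \<le> p"
        moreover have "Suc q \<le> card Y"
          using False card_M XY(2) by simp
        moreover have "\<forall>a\<in>A. \<forall>y\<in>Y. E a y"
          using pieceD(6)[OF less.prems] sub(4) sympD[OF E(1)] by auto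
        ultimately have "biclique E V (Suc p) (Suc q)"
          using join MA sub \<open>card A + card X = card (A \<union> X)\<close>
          by (intro bicliqueI_ge[of "A \<union> X" _ Y]) auto
        then show False
          using E(5) by simp
      qed
      have join': "\<forall>y\<in>Y. \<forall>x\<in>X. E y x"
        using join E(1) by (auto dest: sympD)
      have "\<forall>y\<in>Y. \<forall>z\<in>V - Y. E y z \<longleftrightarrow> z \<in> A \<union> X"
        using MA(2,4) sub(1) join' by blast
      moreover have "A \<union> X \<subseteq> V - Y"
        using MA(1,2) sub(1,2) by blast
      ultimately have "piece E V p Y (A \<union> X)"
        using MA(1) sub(4,6) le_p \<open>card A + card X = card (A \<union> X)\<close> unfolding piece_def by auto
      then have "of_nat (weight E Y (A \<union> X)) \<le> c * of_nat (card Y)"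
        using less.hyps lt by blast
      moreover have "weight E M A = weight E Y (A \<union> X) + weight E X A"
        using arcs_union_complete[OF E(1) fin sub(2) join] sub(1) card_M
          \<open>card A + card X = card (A \<union> X)\<close>[symmetric] by (simp add: weight_def algebra_simps)
      moreover have "of_nat (weight E X A) \<le> c * of_nat (card X)"
      proof -
        obtain x where x: "card X = Suc x"
          using pos gr0_implies_Suc by blast
        have "weight E X A \<le> card X * x + 2 * card A * card X"
          using arcs_le[OF E(2) fin(1)] x by (simp add: weight_def)
        also have "\<dots> \<le> card X * (2 * card A + 2 * x)"
          by (simp add: algebra_simps)
        finally have "of_nat (weight E X A) \<le> (of_nat (card X * (2 * card A + 2 * x)) :: rat)"
          by (rule of_nat_mono)
        also have "\<dots> = of_nat (card X) * of_nat (2 * card A + 2 * x)"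
          by simp
        also have "\<dots> \<le> of_nat (card X) * c"
        proof (intro mult_left_mono)
          have "(of_nat (2 * card A + 2 * x + 2) :: rat) \<le> of_nat (2 * p)"
            using le_p x by (intro of_nat_mono) simp
          then show "of_nat (2 * card A + 2 * x) \<le> c"
            using c by simp
        qed simp
        finally show ?thesis
          by (simp add: mult.commute)
      qed
      ultimately show ?thesis
        unfolding card_M by (simp add: distrib_left)
    qed
  qed
qed

section \<open>Graphs fulfilling a profile\<close>

lemma adj_commute: "adj G u v \<longleftrightarrow> adj G v u"
  by (simp add: adj_def insert_commute)

lemma symp_adj: "symp (adj G)"
  by (simp add: symp_def adj_commute)

lemma irreflp_adj: "simple_graph G \<Longrightarrow> irreflp (adj G)"
  by (auto simp: irreflp_def adj_def simple_graph_def)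

lemma adj_verts:
  assumes "simple_graph G" "adj G u v"
  shows "u \<in> verts G" "v \<in> verts G"
  using assms by (auto simp: adj_def simple_graph_def)

lemma finite_verts: "simple_graph G \<Longrightarrow> finite (verts G)"
  by (simp add: simple_graph_def)

lemma finite_edges: "simple_graph G \<Longrightarrow> finite (edges G)"
  by (rule finite_subset[of _ "Pow (verts G)"]) (auto simp: simple_graph_def)

lemma arcs_eq_card_edges:
  assumes "simple_graph G"
  shows "arcs (adj G) (verts G) = 2 * card (edges G)"
proof -
  have "arcs (adj G) (verts G) = card {(x, y). x \<in> verts G \<and> y \<in> verts G \<and> adj G x y}"
  proof -
    have "arcs (adj G) (verts G) = (\<Sum>z\<in>verts G \<times> verts G. of_bool (adj G (fst z) (snd z)))"
      by (simp add: arcs_def sum.cartesian_product case_prod_unfold del: sum_of_bool_eq)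
    also have "\<dots> = card {z \<in> verts G \<times> verts G. adj G (fst z) (snd z)}"
      using finite_verts[OF assms] by (simp add: Int_def)
    also have "{z \<in> verts G \<times> verts G. adj G (fst z) (snd z)} =
        {(x, y). x \<in> verts G \<and> y \<in> verts G \<and> adj G x y}"
      by auto
    finally show ?thesis .
  qed
  also have "{(x, y). x \<in> verts G \<and> y \<in> verts G \<and> adj G x y} = (\<Union>e\<in>edges G. {(x, y). {x, y} = e})"
    using adj_verts[OF assms] by (auto simp: adj_def)
  also have "card \<dots> = (\<Sum>e\<in>edges G. card {(x, y). {x, y} = e})"
  proof (intro card_UN_disjoint ballI)
    show "finite {(x, y). {x, y} = e}" if "e \<in> edges G" for e
    proof (rule finite_subset)
      show "{(x, y). {x, y} = e} \<subseteq> e \<times> e"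
        by auto
      have "finite e"
        using that assms finite_subset unfolding simple_graph_def by metis
      then show "finite (e \<times> e)"
        by simp
    qed
  qed (use finite_edges[OF assms] in auto)
  also have "\<dots> = (\<Sum>e\<in>edges G. 2)"
  proof (intro sum.cong refl)
    fix e assume "e \<in> edges G"
    then obtain a b where "e = {a, b}" "a \<noteq> b"
      using assms by (auto simp: simple_graph_def card_2_iff)
    then have "{(x, y). {x, y} = e} = {(a, b), (b, a)}"
      by (auto simp: doubleton_eq_iff)
    then show "card {(x, y). {x, y} = e} = 2"
      using \<open>a \<noteq> b\<close> by simp
  qed
  finally show ?thesis
    by simp
qed

lemma contains_copy_complete_bipartite:
  assumes "simple_graph G"
  shows "contains_copy (complete_bipartite j l) G \<longleftrightarrow> biclique (adj G) (verts G) j l"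
proof
  have adj_K: "adj (complete_bipartite j l) u v \<longleftrightarrow>
      u < j \<and> j \<le> v \<and> v < j + l \<or> v < j \<and> j \<le> u \<and> u < j + l" for u v
    by (auto simp: adj_def complete_bipartite_def doubleton_eq_iff)
  {
    assume "contains_copy (complete_bipartite j l) G"
    then obtain f where f: "inj_on f {..<j + l}" "f ` {..<j + l} \<subseteq> verts G"
      "\<And>u v. u < j + l \<Longrightarrow> v < j + l \<Longrightarrow> adj (complete_bipartite j l) u v \<Longrightarrow> adj G (f u) (f v)"
      unfolding contains_copy_def by (auto simp: complete_bipartite_def)
    have "f ` {..<j} \<inter> f ` {j..<j + l} = f ` ({..<j} \<inter> {j..<j + l})"
      by (intro inj_on_image_Int[OF f(1), symmetric]) auto
    moreover have "{..<j} \<inter> {j..<j + l} = {}"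
      by auto
    ultimately have disj: "f ` {..<j} \<inter> f ` {j..<j + l} = {}"
      by simp
    have "inj_on f {..<j}" "inj_on f {j..<j + l}"
      by (rule inj_on_subset[OF f(1)]; auto)+
    then have card: "card (f ` {..<j}) = j" "card (f ` {j..<j + l}) = l"
      by (simp_all add: card_image)
    have "adj G (f u) (f v)" if "u < j" "j \<le> v" "v < j + l" for u v
      using f(3)[of u v] that by (simp add: adj_K)
    then have "\<forall>x\<in>f ` {..<j}. \<forall>y\<in>f ` {j..<j + l}. adj G x y"
      by simp
    moreover have "f ` {..<j} \<subseteq> verts G" "f ` {j..<j + l} \<subseteq> verts G"
      using f(2) by auto
    ultimately show "biclique (adj G) (verts G) j l"
      unfolding biclique_def using disj card by blast
  }
  {
    assume "biclique (adj G) (verts G) j l"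
    then obtain X Y where XY: "X \<subseteq> verts G" "Y \<subseteq> verts G" "X \<inter> Y = {}" "card X = j" "card Y = l"
      "\<forall>x\<in>X. \<forall>y\<in>Y. adj G x y"
      unfolding biclique_def by blast
    then have "finite X" "finite Y"
      using finite_verts[OF assms] finite_subset by blast+
    then obtain g h where g: "bij_betw g {0..<j} X" and h: "bij_betw h {0..<l} Y"
      using ex_bij_betw_nat_finite XY(4,5) by metis
    define f where "f i = (if i < j then g i else h (i - j))" for i
    have fX: "f i \<in> X" if "i < j" for i
      using that bij_betwE[OF g] by (simp add: f_def)
    have fY: "f i \<in> Y" if "j \<le> i" "i < j + l" for i
      using that bij_betwE[OF h] by (simp add: f_def)
    have "inj_on f {..<j + l}"
    proof (rule inj_onI)
      fix u v assume uv: "u \<in> {..<j + l}" "v \<in> {..<j + l}" "f u = f v"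
      then have side: "u < j \<longleftrightarrow> v < j"
        using fX[of u] fX[of v] fY[of u] fY[of v] XY(3) by (metis disjoint_iff lessThan_iff not_le)
      show "u = v"
      proof (cases "u < j")
        case True
        then have "g u = g v"
          using uv(3) side by (simp add: f_def)
        then show ?thesis
          using inj_onD[OF bij_betw_imp_inj_on[OF g]] True side by simp
      next
        case False
        then have "h (u - j) = h (v - j)"
          using uv(3) side by (simp add: f_def)
        then have "u - j = v - j"
          using inj_onD[OF bij_betw_imp_inj_on[OF h]] False side uv(1,2) by simp
        then show ?thesis
          using False side by simp
      qed
    qed
    moreover have "adj G (f u) (f v)"
      if "adj (complete_bipartite j l) u v" for u v
    proof -
      have "adj G (f u) (f v) \<or> adj G (f v) (f u)"
        using that fX fY XY(6) unfolding adj_K by blast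
      then show ?thesis
        by (auto simp: adj_def insert_commute)
    qed
    moreover have "f i \<in> verts G" if "i < j + l" for i
      using that fX[of i] fY[of i] XY(1,2) by (cases "i < j") auto
    ultimately show "contains_copy (complete_bipartite j l) G"
      unfolding contains_copy_def by (intro exI[of _ f]) (auto simp: complete_bipartite_def)
  }
qed

lemma contains_induced_copy_path_graph_4:
  assumes "simple_graph G"
  shows "contains_induced_copy (path_graph 4) G \<longleftrightarrow> \<not> P4_free (adj G) (verts G)"
proof
  have adj_P: "adj (path_graph 4) u v \<longleftrightarrow> v = Suc u \<and> v < 4 \<or> u = Suc v \<and> u < 4" for u v
    by (auto simp: adj_def path_graph_def doubleton_eq_iff)
  have verts_P: "verts (path_graph 4) = {0, 1, 2, 3}"
    by (auto simp: path_graph_def)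
  {
    assume "contains_induced_copy (path_graph 4) G"
    then obtain f where f: "inj_on f {0, 1, 2, 3::nat}" "f ` {0, 1, 2, 3} \<subseteq> verts G"
      "\<forall>u\<in>{0, 1, 2, 3}. \<forall>v\<in>{0, 1, 2, 3}. adj (path_graph 4) u v \<longleftrightarrow> adj G (f u) (f v)"
      unfolding contains_induced_copy_def verts_P by (elim exE conjE) (rule that)
    have "adj G (f 0) (f 1)" "adj G (f 1) (f 2)" "adj G (f 2) (f 3)"
      "\<not> adj G (f 0) (f 2)" "\<not> adj G (f 0) (f 3)" "\<not> adj G (f 1) (f 3)"
      using f(3) by (auto simp: adj_P)
    moreover have "distinct [f 0, f 1, f 2, f 3]"
      using f(1) by simp
    moreover have "f 0 \<in> verts G" "f 1 \<in> verts G" "f 2 \<in> verts G" "f 3 \<in> verts G"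
      using f(2) by auto
    ultimately show "\<not> P4_free (adj G) (verts G)"
      unfolding P4_free_def by blast
  }
  {
    assume "\<not> P4_free (adj G) (verts G)"
    then obtain a b c d where abcd: "{a, b, c, d} \<subseteq> verts G" "distinct [a, b, c, d]"
      "adj G a b" "adj G b c" "adj G c d" "\<not> adj G a c" "\<not> adj G a d" "\<not> adj G b d"
      by (rule not_P4_freeE)
    define f where "f i = [a, b, c, d] ! i" for i
    have f: "f 0 = a" "f 1 = b" "f 2 = c" "f 3 = d" "f (Suc 0) = b"
      by (simp_all add: f_def numeral_eq_Suc)
    have "adj G b a" "adj G c b" "adj G d c" "\<not> adj G c a" "\<not> adj G d a" "\<not> adj G d b"
      using abcd(3-) by (simp_all add: adj_def insert_commute)
    moreover have "\<not> adj G x x" for x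
      using irreflp_adj[OF assms] by (simp add: irreflpD)
    ultimately have "\<forall>u\<in>{0, 1, 2, 3}. \<forall>v\<in>{0, 1, 2, 3}. adj (path_graph 4) u v \<longleftrightarrow> adj G (f u) (f v)"
      using abcd(3-) by (simp add: adj_P f)
    moreover have "inj_on f {0, 1, 2, 3}" "f ` {0, 1, 2, 3} \<subseteq> verts G"
      using abcd(1,2) by (auto simp: f)
    ultimately show "contains_induced_copy (path_graph 4) G"
      unfolding contains_induced_copy_def verts_P by blast
  }
qed

definition admissible :: "(nat \<Rightarrow> nat \<Rightarrow> bool) \<Rightarrow> 'a ugraph \<Rightarrow> bool" where
  "admissible Q G \<longleftrightarrow> simple_graph G \<and> P4_free (adj G) (verts G) \<and>
     (\<forall>j l. biclique (adj G) (verts G) j l \<longrightarrow> Q j l)"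

lemma cograph_fulfills_iff:
  "cograph G \<and> fulfills G P \<longleftrightarrow> admissible (\<lambda>j l. ereal (real l) \<le> P j) G"
proof (cases "simple_graph G")
  case True
  then show ?thesis
    by (auto simp: cograph_def fulfills_def biclique_seq_def admissible_def SUP_le_iff
        contains_copy_complete_bipartite contains_induced_copy_path_graph_4)
qed (simp add: cograph_def admissible_def)

definition relabel :: "('a \<Rightarrow> 'b) \<Rightarrow> 'a ugraph \<Rightarrow> 'b ugraph" where
  "relabel f G = \<lparr>verts = f ` verts G, edges = (`) f ` edges G\<rparr>"

lemma verts_relabel: "verts (relabel f G) = f ` verts G"
  by (simp add: relabel_def)

lemma adj_relabel: "inj f \<Longrightarrow> adj (relabel f G) (f u) (f v) \<longleftrightarrow> adj G u v"
  unfolding adj_def relabel_def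
  by (simp add: image_iff) (metis image_empty image_insert inj_image_eq_iff)

lemma simple_graph_relabel:
  assumes "inj f" "simple_graph G"
  shows "simple_graph (relabel f G)"
proof -
  have "card (f ` e) = card e" for e
    using assms(1) by (simp add: card_image inj_on_subset)
  then show ?thesis
    using assms(2) by (auto simp: simple_graph_def relabel_def)
qed

lemma card_verts_relabel: "inj f \<Longrightarrow> card (verts (relabel f G)) = card (verts G)"
  by (simp add: verts_relabel card_image inj_on_subset)

lemma arcs_relabel: "inj f \<Longrightarrow> arcs (adj (relabel f G)) (f ` M) = arcs (adj G) M"
  by (intro arcs_image) (auto simp: adj_relabel intro: inj_on_subset)

lemma biclique_relabel:
  assumes "inj f" "biclique (adj (relabel f G)) (verts (relabel f G)) j l"
  shows "biclique (adj G) (verts G) j l"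
proof -
  obtain X Y where XY: "X \<subseteq> f ` verts G" "Y \<subseteq> f ` verts G" "X \<inter> Y = {}" "card X = j" "card Y = l"
      "\<forall>x\<in>X. \<forall>y\<in>Y. adj (relabel f G) x y"
    using assms(2) unfolding biclique_def verts_relabel by blast
  then obtain X' Y' where X'Y': "X' \<subseteq> verts G" "X = f ` X'" "Y' \<subseteq> verts G" "Y = f ` Y'"
    by (metis subset_imageE)
  then show ?thesis
    unfolding biclique_def using XY(3-) assms(1)
    by (intro exI[of _ X'] exI[of _ Y']) (auto simp: adj_relabel card_image inj_on_subset)
qed

lemma admissible_relabel:
  assumes "inj f" "admissible Q G"
  shows "admissible Q (relabel f G)"
  using assms simple_graph_relabel[OF assms(1)] biclique_relabel[OF assms(1)]
  unfolding admissible_def P4_free_def verts_relabel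
  by (auto simp: adj_relabel inj_eq)

lemma piece_relabel:
  assumes "inj f" "piece (adj G) (verts G) p M A"
  shows "piece (adj (relabel f G)) (verts (relabel f G)) p (f ` M) (f ` A)"
  using assms unfolding piece_def verts_relabel
  by (auto simp: adj_relabel inj_eq card_image inj_on_subset inj_image_mem_iff)

lemma weight_relabel:
  "inj f \<Longrightarrow> weight (adj (relabel f G)) (f ` M) (f ` A) = weight (adj G) M A"
  by (simp add: weight_def arcs_relabel card_image inj_on_subset)

lemma admissible_add_isolated:
  assumes "admissible Q G" "finite W" "\<And>j l. j = 0 \<or> l = 0 \<Longrightarrow> Q j l"
  shows "admissible Q (G\<lparr>verts := verts G \<union> W\<rparr>)"
proof -
  let ?G = "G\<lparr>verts := verts G \<union> W\<rparr>"
  have G: "simple_graph G" "P4_free (adj G) (verts G)" "\<And>j l. biclique (adj G) (verts G) j l \<Longrightarrow> Q j l"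
    using assms(1) by (auto simp: admissible_def)
  have adj: "adj ?G = adj G"
    by (simp add: adj_def fun_eq_iff)
  have "simple_graph ?G"
    using G(1) assms(2) by (auto simp: simple_graph_def)
  moreover have "P4_free (adj G) (verts G \<union> W)"
    using G(2) adj_verts[OF G(1)] unfolding P4_free_def by meson
  moreover have "Q j l" if biclique: "biclique (adj G) (verts G \<union> W) j l" for j l
  proof (cases "j = 0 \<or> l = 0")
    case False
    obtain X Y where XY: "X \<inter> Y = {}" "card X = j" "card Y = l" "\<forall>x\<in>X. \<forall>y\<in>Y. adj G x y"
      using biclique unfolding biclique_def by blast
    then have "X \<noteq> {}" "Y \<noteq> {}"
      using False by auto
    then have "X \<subseteq> verts G" "Y \<subseteq> verts G"
      using XY(4) adj_verts[OF G(1)] by blast+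
    then show ?thesis
      using G(3) XY unfolding biclique_def by blast
  qed (use assms(3) in blast)
  ultimately show ?thesis
    by (simp add: admissible_def adj)
qed

definition induced :: "'a ugraph \<Rightarrow> 'a set \<Rightarrow> 'a ugraph" where
  "induced G M = \<lparr>verts = M, edges = {e \<in> edges G. e \<subseteq> M}\<rparr>"

lemma verts_induced [simp]: "verts (induced G M) = M"
  by (simp add: induced_def)

lemma adj_induced: "adj (induced G M) u v \<longleftrightarrow> adj G u v \<and> u \<in> M \<and> v \<in> M"
  by (auto simp: adj_def induced_def)

lemma induced_subgraph_induced:
  "simple_graph G \<Longrightarrow> M \<subseteq> verts G \<Longrightarrow> induced_subgraph (induced G M) G"
  by (auto simp: induced_subgraph_def subgraph_def simple_graph_def induced_def intro: finite_subset)

lemma piece_designated_component: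
  assumes "simple_graph G" "piece (adj G) (verts G) p M A"
  shows "designated_component (induced G M) G" "same_outer_nbhd (induced G M) G"
proof -
  note piece = pieceD[OF assms(2)]
  show "designated_component (induced G M) G"
    using piece induced_subgraph_induced[OF assms(1)] by (simp add: designated_component_def)
  have "nbhd G u - M = A" if "u \<in> M" for u
    using that piece unfolding nbhd_def by blast
  then show "same_outer_nbhd (induced G M) G"
    by (simp add: same_outer_nbhd_def)
qed

section \<open>Pumping\<close>

locale graph_piece =
  fixes G :: "'a ugraph" and p :: nat and M A :: "'a set"
  assumes simple: "simple_graph G" and piece: "piece (adj G) (verts G) p M A"
begin

abbreviation pumped :: "nat \<Rightarrow> ('a \<times> nat) ugraph" where
  "pumped k \<equiv> pump G (induced G M) k"

lemmas M = pieceD[OF piece]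

lemma finite_M: "finite M" and finite_A: "finite A" and finite_V: "finite (verts G)"
  using piece_finite[OF piece] finite_verts[OF simple] by auto

lemma verts_pumped: "verts (pumped k) = (verts G - M) \<times> {0} \<union> M \<times> {1..k + 1}"
  by (simp add: pump_def)

lemma mem_verts_pumped:
  "x \<in> verts (pumped k) \<longleftrightarrow>
     fst x \<in> verts G \<and> (if fst x \<in> M then 1 \<le> snd x \<and> snd x \<le> k + 1 else snd x = 0)"
  using M(1) by (cases x) (auto simp: verts_pumped)

lemma fst_mem_M: "x \<in> verts (pumped k) \<Longrightarrow> fst x \<in> M \<longleftrightarrow> snd x \<noteq> 0"
  by (auto simp: mem_verts_pumped split: if_splits)

lemma adj_pumped:
  assumes "x \<in> verts (pumped k)" "y \<in> verts (pumped k)"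
  shows "adj (pumped k) x y \<longleftrightarrow>
    adj G (fst x) (fst y) \<and> (snd x = snd y \<or> snd x = 0 \<or> snd y = 0)"
proof -
  obtain u i v j where xy: "x = (u, i)" "y = (v, j)"
    by (metis surj_pair)
  have "adj (pumped k) (u, i) (v, j) \<longleftrightarrow>
     u \<notin> M \<and> v \<notin> M \<and> i = 0 \<and> j = 0 \<and> u \<in> verts G \<and> v \<in> verts G \<and> adj G u v \<or>
     u \<in> M \<and> v \<in> M \<and> i = j \<and> i \<in> {1..k+1} \<and> adj G u v \<or>
     u \<in> M \<and> v \<notin> M \<and> v \<in> verts G \<and> i \<in> {1..k+1} \<and> j = 0 \<and> adj G u v \<or>
     v \<in> M \<and> u \<notin> M \<and> u \<in> verts G \<and> j \<in> {1..k+1} \<and> i = 0 \<and> adj G u v"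
  proof -
    have "{(u, i), (v, j)} \<in> {{(u, 0), (v, 0)} | u v. u \<in> verts G - M \<and> v \<in> verts G - M \<and> adj G u v}
      \<longleftrightarrow> u \<notin> M \<and> v \<notin> M \<and> i = 0 \<and> j = 0 \<and> u \<in> verts G \<and> v \<in> verts G \<and> adj G u v"
      by (auto simp: doubleton_eq_iff adj_commute)
    moreover have "{(u, i), (v, j)} \<in> {{(u, i), (v, i)} | u v i. i \<in> {1..k + 1} \<and> adj (induced G M) u v}
      \<longleftrightarrow> u \<in> M \<and> v \<in> M \<and> i = j \<and> i \<in> {1..k+1} \<and> adj G u v"
      by (auto simp: doubleton_eq_iff adj_commute adj_induced)
    moreover have "{(u, i), (v, j)} \<in> {{(v, i), (w, 0)} | v w i. i \<in> {1..k + 1} \<and>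
             v \<in> M \<and> w \<in> verts G - M \<and> adj G v w}
      \<longleftrightarrow> u \<in> M \<and> v \<notin> M \<and> v \<in> verts G \<and> i \<in> {1..k+1} \<and> j = 0 \<and> adj G u v \<or>
        v \<in> M \<and> u \<notin> M \<and> u \<in> verts G \<and> j \<in> {1..k+1} \<and> i = 0 \<and> adj G u v"
      by (auto simp: doubleton_eq_iff adj_commute)
    ultimately show ?thesis
      unfolding adj_def[of "pumped k"] unfolding pump_def by (simp only: verts_induced ugraph.simps Un_iff disj_assoc)
  qed
  then show ?thesis
    using assms unfolding xy by (auto simp: mem_verts_pumped split: if_splits)
qed

lemma adj_pumped_outside:
  assumes "x \<in> verts (pumped k)" "y \<in> verts (pumped k)" "snd x = 0" "snd y \<noteq> 0"
  shows "adj (pumped k) x y \<longleftrightarrow> fst x \<in> A"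
proof -
  have "fst x \<in> verts G - M" "fst y \<in> M"
    using assms by (auto simp: mem_verts_pumped split: if_splits)
  then show ?thesis
    using assms M(5) sympD[OF symp_adj, of G] by (auto simp: adj_pumped)
qed

lemma simple_graph_pumped: "simple_graph (pumped k)"
proof -
  have "adj G u v \<Longrightarrow> u \<noteq> v" for u v
    using irreflp_adj[OF simple] by (auto simp: irreflp_def)
  then show ?thesis
    using finite_V finite_M adj_verts[OF simple] M(1)
    by (auto simp: simple_graph_def pump_def adj_induced card_2_iff')
qed

lemma card_verts_pumped: "card (verts (pumped k)) = card (verts G) + k * card M"
proof -
  have "card (verts (pumped k)) = card (verts G - M) + card M * (k + 1)"
    unfolding verts_pumped using finite_V finite_M by (subst card_Un_disjoint) auto
  then show ?thesis
    using M(1) finite_M finite_V card_mono[OF finite_V M(1)] by (simp add: card_Diff_subset)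
qed

lemma arcs_outside: "arcs (adj G) (verts G) = arcs (adj G) (verts G - M) + weight (adj G) M A"
proof -
  have "\<forall>x\<in>verts G - M. \<forall>y\<in>M. adj G x y \<longleftrightarrow> x \<in> A"
    using M(5) sympD[OF symp_adj, of G] by blast
  then have "arcs (adj G) ((verts G - M) \<union> M) =
      arcs (adj G) (verts G - M) + arcs (adj G) M + 2 * card A * card M"
    using M(3) finite_V finite_M symp_adj by (intro arcs_union_module) auto
  moreover have "(verts G - M) \<union> M = verts G"
    using M(1) by blast
  ultimately show ?thesis
    by (simp add: weight_def)
qed

lemma arcs_copies:
  assumes "m \<le> k + 1"
  shows "arcs (adj (pumped k)) (M \<times> {1..m}) = m * arcs (adj G) M"
  using assms
proof (induction m)
  case 0
  then show ?case by (simp add: arcs_def)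
next
  case (Suc m)
  have "arcs (adj (pumped k)) ((\<lambda>v. (v, Suc m)) ` M) = arcs (adj G) M"
    using subsetD[OF M(1)] Suc.prems
    by (intro arcs_image) (auto simp: adj_pumped mem_verts_pumped inj_on_def)
  moreover have "arcs (adj (pumped k)) (M \<times> {1..m} \<union> (\<lambda>v. (v, Suc m)) ` M) =
    arcs (adj (pumped k)) (M \<times> {1..m}) + arcs (adj (pumped k)) ((\<lambda>v. (v, Suc m)) ` M)"
    using subsetD[OF M(1)] finite_M Suc.prems symp_adj
    by (intro arcs_union_anticomplete) (auto simp: adj_pumped mem_verts_pumped)
  moreover have "M \<times> {1..Suc m} = M \<times> {1..m} \<union> (\<lambda>v. (v, Suc m)) ` M"
    by (auto simp: le_Suc_eq)
  ultimately show ?case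
    using Suc by simp
qed

lemma arcs_pumped: "arcs (adj (pumped k)) (verts (pumped k)) = arcs (adj G) (verts G) + k * weight (adj G) M A"
proof -
  have "arcs (adj (pumped k)) ((verts G - M) \<times> {0} \<union> M \<times> {1..k + 1}) =
    arcs (adj (pumped k)) ((verts G - M) \<times> {0}) + arcs (adj (pumped k)) (M \<times> {1..k + 1})
      + 2 * card (A \<times> {0::nat}) * card (M \<times> {1..k + 1})"
  proof (intro arcs_union_module symp_adj ballI)
    fix x y assume "x \<in> (verts G - M) \<times> {0::nat}" "y \<in> M \<times> {1..k + 1}"
    then show "adj (pumped k) x y \<longleftrightarrow> x \<in> A \<times> {0}"
      by (subst adj_pumped_outside) (auto simp: verts_pumped)
  qed (use M finite_V finite_M in auto)
  moreover have "arcs (adj (pumped k)) ((\<lambda>v. (v, 0)) ` (verts G - M)) = arcs (adj G) (verts G - M)"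
    by (intro arcs_image) (auto simp: adj_pumped mem_verts_pumped inj_on_def)
  moreover have "(\<lambda>v. (v, 0::nat)) ` (verts G - M) = (verts G - M) \<times> {0}"
    by auto
  ultimately show ?thesis
    unfolding verts_pumped arcs_outside using arcs_copies[of "k + 1" k]
    by (simp add: weight_def algebra_simps card_cartesian_product)
qed

lemma inj_on_fst_one_copy:
  assumes "S \<subseteq> verts (pumped k)" "\<And>x y. x \<in> S \<Longrightarrow> y \<in> S \<Longrightarrow> snd x \<noteq> 0 \<Longrightarrow> snd y \<noteq> 0 \<Longrightarrow> snd x = snd y"
  shows "inj_on fst S" "\<And>x y. x \<in> S \<Longrightarrow> y \<in> S \<Longrightarrow> adj (pumped k) x y \<longleftrightarrow> adj G (fst x) (fst y)"
proof -
  show "inj_on fst S"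
  proof (rule inj_onI)
    fix x y assume xy: "x \<in> S" "y \<in> S" "fst x = fst y"
    then have "snd x = 0 \<longleftrightarrow> snd y = 0"
      using fst_mem_M[OF subsetD[OF assms(1) xy(1)]] fst_mem_M[OF subsetD[OF assms(1) xy(2)]] by auto
    then have "snd x = snd y"
      using assms(2)[OF xy(1,2)] by (cases "snd x = 0") auto
    then show "x = y"
      using xy(3) by (simp add: prod_eq_iff)
  qed
  show "adj (pumped k) x y \<longleftrightarrow> adj G (fst x) (fst y)" if "x \<in> S" "y \<in> S" for x y
    using adj_pumped[OF subsetD[OF assms(1) that(1)] subsetD[OF assms(1) that(2)]] assms(2)[OF that]
    by auto
qed

lemma P4_free_pumped:
  assumes "P4_free (adj G) (verts G)"
  shows "P4_free (adj (pumped k)) (verts (pumped k))"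
proof (rule ccontr)
  let ?E = "adj (pumped k)"
  assume "\<not> P4_free ?E (verts (pumped k))"
  then obtain a b c d where abcd: "{a, b, c, d} \<subseteq> verts (pumped k)" "distinct [a, b, c, d]"
      "?E a b" "?E b c" "?E c d" "\<not> ?E a c" "\<not> ?E a d" "\<not> ?E b d"
    by (rule not_P4_freeE)
  have sym: "?E x y \<longleftrightarrow> ?E y x" for x y
    by (rule adj_commute)
  have out: "?E x y \<longleftrightarrow> fst x \<in> A" if "x \<in> {a, b, c, d}" "y \<in> {a, b, c, d}" "snd x = 0" "snd y \<noteq> 0" for x y
    by (rule adj_pumped_outside[OF subsetD[OF abcd(1) that(1)] subsetD[OF abcd(1) that(2)] that(3,4)])
  have same: "snd x = snd y" if "?E x y" "x \<in> {a, b, c, d}" "y \<in> {a, b, c, d}" "snd x \<noteq> 0" "snd y \<noteq> 0" for x y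
    using that(1,4,5) adj_pumped[OF subsetD[OF abcd(1) that(2)] subsetD[OF abcd(1) that(3)]] by simp
  have module: "snd a = 0 \<or> snd b = 0 \<or> snd c = 0 \<or> snd d = 0 \<longrightarrow>
      snd a = 0 \<and> snd b = 0 \<and> snd c = 0 \<or> snd a = 0 \<and> snd b = 0 \<and> snd d = 0 \<or>
      snd a = 0 \<and> snd c = 0 \<and> snd d = 0 \<or> snd b = 0 \<and> snd c = 0 \<and> snd d = 0"
    using abcd(3-8) out[of a b] out[of a c] out[of a d] out[of b a] out[of b c] out[of b d]
      out[of c a] out[of c b] out[of c d] out[of d a] out[of d b] out[of d c]
      sym[of a b] sym[of a c] sym[of a d] sym[of b c] sym[of b d] sym[of c d]
    by (simp only: insert_iff) argo
  have "\<exists>z. \<forall>w\<in>{a, b, c, d}. snd w \<noteq> 0 \<longrightarrow> snd w = z"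
  proof (cases "snd a = 0 \<or> snd b = 0 \<or> snd c = 0 \<or> snd d = 0")
    case True
    then consider "snd a = 0" "snd b = 0" "snd c = 0" | "snd a = 0" "snd b = 0" "snd d = 0"
      | "snd a = 0" "snd c = 0" "snd d = 0" | "snd b = 0" "snd c = 0" "snd d = 0"
      using module by argo
    then show ?thesis
      by cases auto
  next
    case False
    then have "snd a = snd b" "snd b = snd c" "snd c = snd d"
      using same[OF abcd(3)] same[OF abcd(4)] same[OF abcd(5)] by simp_all
    then show ?thesis
      by simp
  qed
  then have "snd x = snd y" if "x \<in> {a, b, c, d}" "y \<in> {a, b, c, d}" "snd x \<noteq> 0" "snd y \<noteq> 0" for x y
    using that by metis
  note one_copy = inj_on_fst_one_copy[OF abcd(1) this]
  have "distinct (map fst [a, b, c, d])"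
    using abcd(2) one_copy(1) unfolding distinct_map by simp
  then have "distinct [fst a, fst b, fst c, fst d]"
    by simp
  moreover have "{fst a, fst b, fst c, fst d} \<subseteq> verts G"
    using abcd(1) by (auto simp: mem_verts_pumped)
  moreover have "adj G (fst a) (fst b)" "adj G (fst b) (fst c)" "adj G (fst c) (fst d)"
    "\<not> adj G (fst a) (fst c)" "\<not> adj G (fst a) (fst d)" "\<not> adj G (fst b) (fst d)"
    using abcd(3-8) one_copy(2) by auto
  ultimately show False
    using assms unfolding P4_free_def by blast
qed

text \<open>Two vertices in different copies have at most the \<open>card A \<le> p\<close> common neighbours
  in \<open>A\<close>.\<close>

lemma biclique_pumped:
  assumes "biclique (adj (pumped k)) (verts (pumped k)) j l" "p < j" "p < l"
  shows "biclique (adj G) (verts G) j l"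
proof -
  let ?E = "adj (pumped k)"
  have small: "card Y \<le> p"
    if Y: "Y \<subseteq> verts (pumped k)" and xy: "x \<in> verts (pumped k)" "y \<in> verts (pumped k)"
      "snd x \<noteq> 0" "snd y \<noteq> 0" "snd x \<noteq> snd y" and E: "\<forall>z\<in>Y. ?E x z \<and> ?E y z" for x y Y
  proof -
    have "z \<in> A \<times> {0}" if "z \<in> Y" for z
    proof -
      have "snd z = 0"
        using E that adj_pumped[OF xy(1) subsetD[OF Y that]] adj_pumped[OF xy(2) subsetD[OF Y that]] xy(3-5)
        by auto
      moreover have "?E z x"
        using that E adj_commute[of "pumped k"] by blast
      ultimately show ?thesis
        using that Y xy adj_pumped_outside[of z k x] by (cases z) auto
    qed
    then have "card Y \<le> card (A \<times> {0::nat})"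
      using finite_A by (intro card_mono) auto
    then show ?thesis
      using M(4) by (simp add: card_cartesian_product)
  qed
  obtain X Y where XY: "X \<subseteq> verts (pumped k)" "Y \<subseteq> verts (pumped k)" "X \<inter> Y = {}" "card X = j"
      "card Y = l" "\<forall>x\<in>X. \<forall>y\<in>Y. ?E x y"
    using assms(1) unfolding biclique_def by blast
  have YX: "\<forall>y\<in>Y. \<forall>x\<in>X. ?E y x"
    using XY(6) adj_commute[of "pumped k"] by blast
  have cross: "snd x = snd y" if "x \<in> X" "y \<in> Y" "snd x \<noteq> 0" "snd y \<noteq> 0" for x y
    using that XY(6) adj_pumped[OF subsetD[OF XY(1) that(1)] subsetD[OF XY(2) that(2)]] by simp
  have "snd x = snd y" if "x \<in> X" "y \<in> X" "snd x \<noteq> 0" "snd y \<noteq> 0" for x y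
    using small[OF XY(2) subsetD[OF XY(1) that(1)] subsetD[OF XY(1) that(2)] that(3,4)]
      XY(5,6) that assms(3) by (meson leD)
  moreover have "snd x = snd y" if "x \<in> Y" "y \<in> Y" "snd x \<noteq> 0" "snd y \<noteq> 0" for x y
    using small[OF XY(1) subsetD[OF XY(2) that(1)] subsetD[OF XY(2) that(2)] that(3,4)]
      XY(4) YX that assms(2) by (meson leD)
  ultimately have "snd x = snd y" if "x \<in> X \<union> Y" "y \<in> X \<union> Y" "snd x \<noteq> 0" "snd y \<noteq> 0" for x y
    using that cross by (metis UnE)
  moreover have "X \<union> Y \<subseteq> verts (pumped k)"
    using XY by blast
  ultimately have one_copy: "inj_on fst (X \<union> Y)"
    "\<And>x y. x \<in> X \<union> Y \<Longrightarrow> y \<in> X \<union> Y \<Longrightarrow> ?E x y \<longleftrightarrow> adj G (fst x) (fst y)"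
    using inj_on_fst_one_copy[of "X \<union> Y" k] by blast+
  have "fst ` X \<inter> fst ` Y = {}"
    using inj_on_image_Int[OF one_copy(1), of X Y] XY(3) by simp
  moreover have "card (fst ` X) = j" "card (fst ` Y) = l"
    using XY(4,5) one_copy(1) by (auto simp: card_image inj_on_Un)
  moreover have "fst ` X \<subseteq> verts G" "fst ` Y \<subseteq> verts G"
    using XY(1,2) mem_verts_pumped by blast+
  moreover have "\<forall>x\<in>fst ` X. \<forall>y\<in>fst ` Y. adj G x y"
    using XY(6) one_copy(2) by auto
  ultimately show ?thesis
    unfolding biclique_def by blast
qed

lemma admissible_pumped:
  assumes "admissible Q G" "\<And>j l. j \<le> p \<or> l \<le> p \<Longrightarrow> Q j l"
  shows "admissible Q (pumped k)"
  using assms simple_graph_pumped P4_free_pumped biclique_pumped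
  unfolding admissible_def by (meson not_le)

lemma piece_copies:
  assumes "1 \<le> m" "m \<le> k + 1"
  shows "piece (adj (pumped k)) (verts (pumped k)) p (M \<times> {1..m}) (A \<times> {0})"
  unfolding piece_def
proof (intro conjI ballI)
  fix x y assume x: "x \<in> M \<times> {1..m}" and y: "y \<in> verts (pumped k) - M \<times> {1..m}"
  have x': "x \<in> verts (pumped k)"
    using x assms by (auto simp: verts_pumped)
  show "adj (pumped k) x y \<longleftrightarrow> y \<in> A \<times> {0}"
  proof (cases "snd y = 0")
    case True
    then show ?thesis
      using adj_pumped_outside[of y k x] x x' y sympD[OF symp_adj, of "pumped k"]
      by (cases y) auto
  next
    case False
    then have "fst y \<in> M" "snd y > m"
      using y by (auto simp: verts_pumped)
    then show ?thesis
      using adj_pumped[OF x', of y] x y by auto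
  qed
qed (use assms M in \<open>auto simp: verts_pumped card_cartesian_product\<close>)

lemma weight_copies:
  assumes "m \<le> k + 1"
  shows "weight (adj (pumped k)) (M \<times> {1..m}) (A \<times> {0}) = m * weight (adj G) M A"
  using arcs_copies[OF assms] by (simp add: weight_def card_cartesian_product algebra_simps)

end

definition complete_graph :: "nat \<Rightarrow> nat ugraph" where
  "complete_graph n = \<lparr>verts = {..<n}, edges = {e. e \<subseteq> {..<n} \<and> card e = 2}\<rparr>"

lemma adj_complete_graph: "adj (complete_graph n) u v \<longleftrightarrow> u < n \<and> v < n \<and> u \<noteq> v"
  by (auto simp: adj_def complete_graph_def card_2_iff doubleton_eq_iff)

lemma not_connectivity_component:
  assumes "simple_graph G" "piece (adj G) (verts G) p M A"
    and split: "A = {} \<Longrightarrow> \<exists>S\<subseteq>M. S \<noteq> {} \<and> S \<noteq> M \<and> (\<forall>x\<in>S. \<forall>y\<in>verts G. adj G x y \<longrightarrow> y \<in> S)"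
  shows "\<not> connectivity_component (induced G M) G"
proof
  assume "connectivity_component (induced G M) G"
  then obtain u where u: "u \<in> verts G" "M = {v \<in> verts G. (adj G)\<^sup>*\<^sup>* u v}"
    unfolding connectivity_component_def by auto
  note M = pieceD[OF assms(2)]
  have "A = {}"
  proof (rule ccontr)
    assume "A \<noteq> {}"
    then obtain a m where "a \<in> A" "m \<in> M"
      using M(2) by blast
    then have "adj G m a" "a \<in> verts G" "a \<notin> M"
      using M(3,6) by auto
    then show False
      using \<open>m \<in> M\<close> u(2) by (auto dest: rtranclp.rtrancl_into_rtrancl)
  qed
  then obtain S where S: "S \<subseteq> M" "S \<noteq> {}" "S \<noteq> M" "\<forall>x\<in>S. \<forall>y\<in>verts G. adj G x y \<longrightarrow> y \<in> S"
    using split by blast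
  then obtain x y where xy: "x \<in> S" "y \<in> M" "y \<notin> S"
    by blast
  have reach_S: "w \<in> S" if "(adj G)\<^sup>*\<^sup>* x w" for w
    using that
  proof induction
    case base
    then show ?case by (rule xy(1))
  next
    case (step v w)
    then show ?case
      using S(4) adj_verts[OF assms(1)] by blast
  qed
  have "(adj G)\<^sup>*\<^sup>* u x" "(adj G)\<^sup>*\<^sup>* u y"
    using xy(1,2) S(1) u(2) by auto
  then have "(adj G)\<^sup>*\<^sup>* x y"
    using sympD[OF symp_rtranclp[OF symp_adj]] rtranclp_trans by metis
  then show False
    using reach_S xy(3) by blast
qed

section \<open>Extremal cographs\<close>

locale biclique_class =
  fixes Q :: "nat \<Rightarrow> nat \<Rightarrow> bool" and p q :: nat
  assumes small: "\<And>j l. j \<le> p \<or> l \<le> p \<Longrightarrow> Q j l"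
    and large: "\<not> Q (Suc p) (Suc q)"
begin

definition ex :: "nat \<Rightarrow> nat" where
  "ex n = Max {card (edges G) | G :: nat ugraph. admissible Q G \<and> card (verts G) = n}"

lemma admissible_simple: "admissible Q G \<Longrightarrow> simple_graph G"
  by (simp add: admissible_def)

lemma admissible_facts:
  assumes "admissible Q G"
  shows "symp (adj G)" "irreflp (adj G)" "finite (verts G)" "P4_free (adj G) (verts G)"
    "\<not> biclique (adj G) (verts G) (Suc p) (Suc q)"
  using assms large symp_adj irreflp_adj finite_verts unfolding admissible_def by blast+

lemma card_edges_le:
  assumes "admissible Q G"
  shows "2 * card (edges G) \<le> (2 * p + q) * card (verts G)"
    and "p \<ge> 1 \<Longrightarrow> verts G \<noteq> {} \<Longrightarrow> 2 * card (edges G) < (2 * p + q) * card (verts G)"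
  using arcs_biclique_free[OF admissible_facts[OF assms]]
  by (simp_all add: arcs_eq_card_edges[OF admissible_simple[OF assms]])

lemma admissible_edgeless:
  assumes "finite W"
  shows "admissible Q \<lparr>verts = W, edges = {}\<rparr>"
proof -
  have "admissible Q \<lparr>verts = {}, edges = {}\<rparr>"
    using small by (auto simp: admissible_def simple_graph_def P4_free_def biclique_def)
  then have "admissible Q (\<lparr>verts = {}, edges = {}\<rparr>\<lparr>verts := verts \<lparr>verts = {}, edges = {}\<rparr> \<union> W\<rparr>)"
    using assms small by (intro admissible_add_isolated) auto
  then show ?thesis
    by simp
qed

lemma finite_edge_numbers:
  "finite {card (edges G) | G :: nat ugraph. admissible Q G \<and> card (verts G) = n}"
proof (rule finite_subset)
  show "{card (edges G) | G :: nat ugraph. admissible Q G \<and> card (verts G) = n} \<subseteq> {..(2 * p + q) * n}"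
  proof clarify
    fix G :: "nat ugraph"
    assume "admissible Q G"
    from card_edges_le(1)[OF this] show "card (edges G) \<le> (2 * p + q) * card (verts G)"
      by linarith
  qed
qed simp

lemma ex_attained:
  obtains G :: "nat ugraph" where "admissible Q G" "card (verts G) = n" "card (edges G) = ex n"
proof -
  have "\<exists>G :: nat ugraph. admissible Q G \<and> card (verts G) = n"
    by (rule exI[of _ "\<lparr>verts = {..<n}, edges = {}\<rparr>"]) (simp add: admissible_edgeless)
  then have "ex n \<in> {card (edges G) | G :: nat ugraph. admissible Q G \<and> card (verts G) = n}"
    unfolding ex_def by (intro Max_in finite_edge_numbers) blast
  then show thesis
    using that by auto
qed

lemma card_edges_le_ex:
  fixes G :: "'b :: countable ugraph"
  assumes "admissible Q G"
  shows "card (edges G) \<le> ex (card (verts G))"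
proof -
  have inj: "inj (to_nat :: 'b \<Rightarrow> nat)"
    by simp
  let ?G = "relabel to_nat G :: nat ugraph"
  have adm: "admissible Q ?G"
    by (rule admissible_relabel[OF inj assms])
  have "2 * card (edges ?G) = 2 * card (edges G)"
    using arcs_eq_card_edges[OF admissible_simple[OF adm]] arcs_eq_card_edges[OF admissible_simple[OF assms]]
      arcs_relabel[OF inj, of G "verts G"] by (simp add: verts_relabel)
  moreover have "card (edges ?G) \<le> ex (card (verts ?G))"
    unfolding ex_def using adm by (intro Max_ge finite_edge_numbers) blast
  ultimately show ?thesis
    by (simp add: card_verts_relabel[OF inj])
qed

lemma ex_less:
  assumes "p \<ge> 1" "n \<ge> 1"
  shows "2 * ex n < (2 * p + q) * n"
proof -
  obtain G :: "nat ugraph" where G: "admissible Q G" "card (verts G) = n" "card (edges G) = ex n"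
    by (rule ex_attained)
  show ?thesis
    using card_edges_le(2)[OF G(1) assms(1)] G assms(2) by (cases "verts G = {}") auto
qed

definition small_pieces :: "(nat \<times> nat) set" where
  "small_pieces = {(card M, weight (adj G) M A) | (G :: nat ugraph) M A.
     admissible Q G \<and> piece (adj G) (verts G) p M A \<and> card M \<le> 2 * Suc q}"

definition densities :: "rat set" where
  "densities = (\<lambda>(h, w). of_nat w / of_nat h) ` small_pieces"

definition slope :: rat where
  "slope = Max densities"

lemma small_piecesI:
  "admissible Q (G :: nat ugraph) \<Longrightarrow> piece (adj G) (verts G) p M A \<Longrightarrow> card M \<le> 2 * Suc q \<Longrightarrow>
    (card M, weight (adj G) M A) \<in> small_pieces"
  unfolding small_pieces_def by blast

lemma piece_weight_le:
  "admissible Q G \<Longrightarrow> piece (adj G) (verts G) p M A \<Longrightarrow> weight (adj G) M A \<le> (2 * p + q) * card M"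
  by (rule weight_le[OF admissible_facts])

lemma small_pieces_bound:
  assumes "(h, w) \<in> small_pieces"
  shows "1 \<le> h" "h \<le> 2 * Suc q" "w \<le> (2 * p + q) * h"
proof -
  obtain G :: "nat ugraph" and M A where G: "admissible Q G" "piece (adj G) (verts G) p M A"
    "h = card M" "w = weight (adj G) M A" "card M \<le> 2 * Suc q"
    using assms unfolding small_pieces_def by blast
  have "finite M" "M \<noteq> {}"
    using piece_finite[OF G(2)] admissible_facts(3)[OF G(1)] pieceD[OF G(2)] by blast+
  then show "1 \<le> h" "h \<le> 2 * Suc q" "w \<le> (2 * p + q) * h"
    using G piece_weight_le[OF G(1,2)] by (simp_all add: card_gt_0_iff Suc_le_eq)
qed

lemma finite_densities: "finite densities"
proof -
  have "small_pieces \<subseteq> {..2 * Suc q} \<times> {..(2 * p + q) * (2 * Suc q)}"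
  proof clarify
    fix h w assume "(h, w) \<in> small_pieces"
    note b = small_pieces_bound[OF this]
    have "(2 * p + q) * h \<le> (2 * p + q) * (2 * Suc q)"
      using b(2) by (intro mult_left_mono) auto
    then have "w \<le> (2 * p + q) * (2 * Suc q)"
      using b(3) by (rule order_trans[rotated])
    then show "h \<in> {..2 * Suc q} \<and> w \<in> {..(2 * p + q) * (2 * Suc q)}"
      using b(2) by simp
  qed
  then have "finite small_pieces"
    by (rule finite_subset) simp
  then show ?thesis
    unfolding densities_def by (rule finite_imageI)
qed

lemma vertex_in_complete_graph: "(1, 2 * p) \<in> small_pieces"
proof -
  let ?K = "complete_graph (Suc p)"
  have verts: "verts ?K = {..p}"
    by (auto simp: complete_graph_def)
  have "simple_graph ?K"
    by (auto simp: simple_graph_def complete_graph_def)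
  moreover have "P4_free (adj ?K) (verts ?K)"
    by (auto simp: P4_free_def verts adj_complete_graph)
  moreover have "Q j l" if "biclique (adj ?K) (verts ?K) j l" for j l
  proof -
    obtain X Y where XY: "X \<subseteq> {..p}" "Y \<subseteq> {..p}" "X \<inter> Y = {}" "card X = j" "card Y = l"
      using \<open>biclique _ _ _ _\<close> unfolding biclique_def verts by blast
    then have "j + l = card (X \<union> Y)"
      using finite_subset[of _ "{..p}"] by (subst card_Un_disjoint) auto
    also have "\<dots> \<le> card {..p}"
      using XY by (intro card_mono) auto
    finally show ?thesis
      by (intro small) auto
  qed
  ultimately have "admissible Q ?K"
    by (simp add: admissible_def)
  moreover have "piece (adj ?K) (verts ?K) p {0} {1..p}"
    by (auto simp: piece_def verts adj_complete_graph)
  ultimately have "(card {0::nat}, weight (adj ?K) {0} {1..p}) \<in> small_pieces"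
    by (rule small_piecesI) simp
  moreover have "weight (adj ?K) {0} {1..p} = 2 * p"
    by (simp add: weight_def arcs_def adj_complete_graph)
  ultimately show ?thesis
    by simp
qed

lemma density_le_slope: "d \<in> densities \<Longrightarrow> d \<le> slope"
  unfolding slope_def by (intro Max_ge finite_densities)

lemma slope_ge: "slope \<ge> 2 * of_nat p"
  using density_le_slope[of "of_nat (2 * p)"] vertex_in_complete_graph
  unfolding densities_def by (force simp: image_iff)

lemma slope_attained:
  obtains h w where "(h, w) \<in> small_pieces" "of_nat w = slope * of_nat h"
proof -
  have "slope \<in> densities"
    unfolding slope_def using finite_densities vertex_in_complete_graph
    by (intro Max_in) (auto simp: densities_def)
  then obtain h w where "(h, w) \<in> small_pieces" "slope = of_nat w / of_nat h"
    unfolding densities_def by auto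
  then show thesis
    using that small_pieces_bound(1) by fastforce
qed

lemma slope_le: "slope \<le> of_nat (2 * p + q)"
proof -
  obtain h w where hw: "(h, w) \<in> small_pieces" "of_nat w = slope * of_nat h"
    by (rule slope_attained)
  have "slope * of_nat h \<le> of_nat (2 * p + q) * of_nat h"
    using small_pieces_bound(3)[OF hw(1)] hw(2) by (metis of_nat_le_iff of_nat_mult)
  then show ?thesis
    using small_pieces_bound(1)[OF hw(1)] by simp
qed

lemma density_in_densities:
  assumes "admissible Q (G :: nat ugraph)" "piece (adj G) (verts G) p M A" "card M \<le> 2 * Suc q"
  shows "of_nat (weight (adj G) M A) / of_nat (card M) \<in> densities" "card M \<ge> 1"
  using small_piecesI[OF assms] small_pieces_bound(1) unfolding densities_def by force+

lemma arcs_le_if_small_pieces: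
  fixes c :: rat
  assumes G: "admissible Q (G :: nat ugraph)" and c: "c \<ge> 2 * of_nat p - 2"
    and dens: "\<And>M A. piece (adj G) (verts G) p M A \<Longrightarrow> card M \<le> 2 * Suc q \<Longrightarrow>
      of_nat (weight (adj G) M A) / of_nat (card M) \<le> c"
  shows "of_nat (2 * card (edges G)) \<le> c * of_nat (card (verts G))"
proof (cases "verts G = {}")
  case True
  then show ?thesis
    using arcs_eq_card_edges[OF admissible_simple[OF G]] by (simp add: arcs_def)
next
  case False
  have "of_nat (weight (adj G) (verts G) {}) \<le> c * of_nat (card (verts G))"
  proof (rule weight_le_if_small_pieces[OF admissible_facts[OF G] c _ piece_self[OF False]])
    fix M A assume MA: "piece (adj G) (verts G) p M A" "card M \<le> 2 * Suc q"
    show "of_nat (weight (adj G) M A) \<le> c * of_nat (card M)"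
      using dens[OF MA] density_in_densities(2)[OF G MA] by (simp add: divide_le_eq)
  qed
  then show ?thesis
    by (simp add: weight_def arcs_eq_card_edges[OF admissible_simple[OF G]])
qed

lemma ex_le_slope: "of_nat (2 * ex n) \<le> slope * of_nat n"
proof -
  obtain G :: "nat ugraph" where G: "admissible Q G" "card (verts G) = n" "card (edges G) = ex n"
    by (rule ex_attained)
  have "of_nat (2 * card (edges G)) \<le> slope * of_nat (card (verts G))"
    using slope_ge density_le_slope density_in_densities(1)[OF G(1)]
    by (intro arcs_le_if_small_pieces[OF G(1)]) auto
  then show ?thesis
    using G by simp
qed

lemma ex_ge_slope:
  obtains C :: rat where "\<And>n. of_nat (2 * ex n) \<ge> slope * of_nat n - C"
proof -
  obtain h w where hw: "(h, w) \<in> small_pieces" "of_nat w = slope * of_nat h"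
    by (rule slope_attained)
  then obtain G :: "nat ugraph" and M A where G: "admissible Q G" "piece (adj G) (verts G) p M A"
    "h = card M" "w = weight (adj G) M A"
    unfolding small_pieces_def by auto
  interpret graph_piece G p M A
    using G by unfold_locales (auto simp: admissible_def)
  let ?m = "card (verts G)"
  have "slope * of_nat n - slope * of_nat (?m + h) \<le> of_nat (2 * ex n)" for n
  proof (cases "n \<ge> ?m")
    case False
    then have "slope * of_nat n \<le> slope * of_nat (?m + h)"
      using slope_ge by (intro mult_left_mono of_nat_mono) auto
    then show ?thesis
      by (simp add: order_trans[OF _ of_nat_0_le_iff])
  next
    case True
    define k where "k = (n - ?m) div h"
    define r where "r = (n - ?m) mod h"
    have n: "n = ?m + k * h + r"
      using True by (simp add: k_def r_def)
    have "r < h"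
      using small_pieces_bound(1)[OF hw(1)] by (simp add: r_def)
    have adm: "admissible Q (pumped k)"
      by (rule admissible_pumped[OF G(1) small])
    obtain W :: "(nat \<times> nat) set" where W: "finite W" "card W = r" "W \<inter> verts (pumped k) = {}"
    proof -
      have "infinite (UNIV - verts (pumped k))"
        using finite_verts[OF simple_graph_pumped] by (simp add: finite_prod)
      then obtain W where "finite W" "card W = r" "W \<subseteq> UNIV - verts (pumped k)"
        using infinite_arbitrarily_large by blast
      then show thesis
        by (intro that) auto
    qed
    let ?G = "(pumped k)\<lparr>verts := verts (pumped k) \<union> W\<rparr>"
    have adm': "admissible Q ?G"
      using admissible_add_isolated[OF adm W(1)] small by auto
    have "card (verts ?G) = n"
      using W finite_verts[OF simple_graph_pumped] n G(3)
      by (simp add: card_Un_disjoint Int_commute card_verts_pumped)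
    then have "card (edges (pumped k)) \<le> ex n"
      using card_edges_le_ex[OF adm'] by simp
    moreover have "2 * card (edges (pumped k)) = 2 * card (edges G) + k * w"
      using arcs_pumped[of k] arcs_eq_card_edges[OF simple_graph_pumped] arcs_eq_card_edges[OF simple] G(4)
      by simp
    ultimately have "of_nat (k * w) \<le> (of_nat (2 * ex n) :: rat)"
      by (intro of_nat_mono) simp
    moreover have "of_nat (k * w) = slope * of_nat (k * h)"
      using hw(2) by simp
    moreover have "slope * of_nat n - slope * of_nat (?m + h) \<le> slope * of_nat (k * h)"
    proof -
      have "slope * of_nat n \<le> slope * of_nat (?m + h + k * h)"
        using slope_ge n \<open>r < h\<close> by (intro mult_left_mono of_nat_mono) auto
      then show ?thesis
        by (simp add: distrib_left)
    qed
    ultimately show ?thesis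
      by linarith
  qed
  then show thesis
    using that by blast
qed

text \<open>Without a small piece of maximal density a graph falls short of the slope by a fixed
  amount per vertex.\<close>

lemma dense_piece:
  obtains n1 where "\<And>n (G :: nat ugraph). n \<ge> n1 \<Longrightarrow> admissible Q G \<Longrightarrow> card (verts G) = n \<Longrightarrow>
    card (edges G) = ex n \<Longrightarrow>
    \<exists>M A. piece (adj G) (verts G) p M A \<and> card M \<le> 2 * Suc q \<and>
      of_nat (weight (adj G) M A) = slope * of_nat (card M)"
proof -
  define \<beta> where "\<beta> = Max (insert (2 * of_nat p - 2) {d \<in> densities. d < slope})"
  have fin: "finite (insert (2 * of_nat p - 2) {d \<in> densities. d < slope})"
    using finite_densities by simp
  have "\<beta> < slope"
    unfolding \<beta>_def using slope_ge by (subst Max_less_iff[OF fin]) auto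
  have \<beta>_ge: "\<beta> \<ge> 2 * of_nat p - 2" "\<And>d. d \<in> densities \<Longrightarrow> d < slope \<Longrightarrow> d \<le> \<beta>"
    unfolding \<beta>_def using fin by (auto intro!: Max_ge)
  obtain C :: rat where C: "\<And>n. of_nat (2 * ex n) \<ge> slope * of_nat n - C"
    using ex_ge_slope by blast
  obtain n1 where n1: "of_nat n1 > C / (slope - \<beta>)"
    using reals_Archimedean2 by blast
  have "\<exists>M A. piece (adj G) (verts G) p M A \<and> card M \<le> 2 * Suc q \<and>
      of_nat (weight (adj G) M A) = slope * of_nat (card M)"
    if n: "n \<ge> n1" and G: "admissible Q G" "card (verts G) = n" "card (edges G) = ex n"
    for n and G :: "nat ugraph"
  proof (rule ccontr)
    assume neg: "\<not> ?thesis"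
    have "of_nat (2 * card (edges G)) \<le> \<beta> * of_nat (card (verts G))"
    proof (rule arcs_le_if_small_pieces[OF G(1) \<beta>_ge(1)])
      fix M A assume MA: "piece (adj G) (verts G) p M A" "card M \<le> 2 * Suc q"
      let ?d = "of_nat (weight (adj G) M A) / of_nat (card M) :: rat"
      note d = density_in_densities[OF G(1) MA]
      have "of_nat (weight (adj G) M A) \<noteq> slope * of_nat (card M)"
        using neg MA by blast
      then have "?d \<noteq> slope"
        using d(2) by (auto simp: field_simps)
      then show "?d \<le> \<beta>"
        using d(1) density_le_slope[OF d(1)] \<beta>_ge(2) by auto
    qed
    then have "slope * of_nat n - C \<le> \<beta> * of_nat n"
      using C[of n] G by simp
    then have "of_nat n * (slope - \<beta>) \<le> C"
      by (simp add: algebra_simps)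
    moreover have "C < of_nat n1 * (slope - \<beta>)"
      using n1 \<open>\<beta> < slope\<close> by (simp add: divide_less_eq)
    moreover have "of_nat n1 * (slope - \<beta>) \<le> of_nat n * (slope - \<beta>)"
      using n \<open>\<beta> < slope\<close> by (intro mult_right_mono) auto
    ultimately show False
      by simp
  qed
  then show thesis
    using that by blast
qed

definition period :: nat where
  "period = 2 * fact (2 * Suc q)"

definition deficit :: "nat \<Rightarrow> rat" where
  "deficit n = slope * of_nat n - of_nat (2 * ex n)"

lemma deficit_minimal:
  assumes "S \<noteq> {}"
  obtains n where "n \<in> S" "\<And>n'. n' \<in> S \<Longrightarrow> deficit n \<le> deficit n'"
proof -
  obtain h w where hw: "(h, w) \<in> small_pieces" "of_nat w = slope * of_nat h"
    by (rule slope_attained)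
  have h: "of_nat h > (0 :: rat)"
    using small_pieces_bound(1)[OF hw(1)] by simp
  have scaled: "of_nat (w * n - 2 * h * ex n) = of_nat h * deficit n" for n
  proof -
    have *: "of_nat (w * n) - of_nat (2 * h * ex n) = of_nat h * deficit n"
      using hw(2) by (simp add: deficit_def algebra_simps)
    moreover have "of_nat h * deficit n \<ge> 0"
      using h ex_le_slope[of n] by (simp add: deficit_def)
    ultimately have "(of_nat (2 * h * ex n) :: rat) \<le> of_nat (w * n)"
      by linarith
    then show ?thesis
      using * by (metis of_nat_diff of_nat_le_iff)
  qed
  obtain n where n: "n \<in> S" "\<And>n'. n' \<in> S \<Longrightarrow> w * n - 2 * h * ex n \<le> w * n' - 2 * h * ex n'"
    using ex_has_least_nat[of "\<lambda>n. n \<in> S" _ "\<lambda>n. w * n - 2 * h * ex n"] assms by blast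
  have "deficit n \<le> deficit n'" if "n' \<in> S" for n'
  proof -
    have "of_nat h * deficit n \<le> of_nat h * deficit n'"
      unfolding scaled[symmetric] using n(2)[OF that] by (rule of_nat_mono)
    then show ?thesis
      using h by simp
  qed
  then show thesis
    using that n(1) by blast
qed

definition core :: "nat \<Rightarrow> nat ugraph \<Rightarrow> nat set \<Rightarrow> nat set \<Rightarrow> rat \<Rightarrow> nat \<Rightarrow> bool" where
  "core r G M A d n0 \<longleftrightarrow>
     admissible Q G \<and> piece (adj G) (verts G) p M A \<and> \<not> connectivity_component (induced G M) G \<and>
     d \<ge> 0 \<and>
     (\<forall>n\<ge>n0. n mod period = r \<longrightarrow> of_nat (2 * ex n) = slope * of_nat n - d \<and>
       (\<exists>k. admissible Q (pump G (induced G M) k) \<and>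
         card (verts (pump G (induced G M) k)) = n \<and>
         card (edges (pump G (induced G M) k)) = ex n))"

text \<open>The designated part of the core consists of at least two copies of a dense piece, which makes
  it different from a connected component. For \<open>s = 1\<close> this is essential: there a single copy may
  be the component \<open>K\<^sub>t\<close>, whose density is the upper bound for \<open>\<alpha>\<close>.\<close>

lemma core_of_residue:
  assumes "r < period"
  shows "\<exists>G M A d n0. core r G M A d n0"
proof -
  obtain n1 where n1: "\<And>n (G :: nat ugraph). n \<ge> n1 \<Longrightarrow> admissible Q G \<Longrightarrow> card (verts G) = n \<Longrightarrow>
    card (edges G) = ex n \<Longrightarrow>
    \<exists>M A. piece (adj G) (verts G) p M A \<and> card M \<le> 2 * Suc q \<and>
      of_nat (weight (adj G) M A) = slope * of_nat (card M)"
    using dense_piece by blast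
  have "period \<ge> 1"
    by (simp add: period_def Suc_le_eq)
  have "r + n1 * period \<in> {n. n \<ge> n1 \<and> n mod period = r}"
    using assms \<open>period \<ge> 1\<close> by (simp add: trans_le_add2)
  then have "{n. n \<ge> n1 \<and> n mod period = r} \<noteq> {}"
    by (metis empty_iff)
  then obtain b where min: "b \<in> {n. n \<ge> n1 \<and> n mod period = r}"
    "\<And>n. n \<in> {n. n \<ge> n1 \<and> n mod period = r} \<Longrightarrow> deficit b \<le> deficit n"
    by (rule deficit_minimal) (rule that)
  then have b: "b \<ge> n1" "b mod period = r"
    "\<And>n. n \<ge> n1 \<Longrightarrow> n mod period = r \<Longrightarrow> deficit b \<le> deficit n"
    by simp_all
  obtain G0 :: "nat ugraph" where G0: "admissible Q G0" "card (verts G0) = b" "card (edges G0) = ex b"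
    by (rule ex_attained)
  obtain M0 A0 where M0: "piece (adj G0) (verts G0) p M0 A0" "card M0 \<le> 2 * Suc q"
    "of_nat (weight (adj G0) M0 A0) = slope * of_nat (card M0)"
    using n1[OF b(1) G0] by blast
  interpret g0: graph_piece G0 p M0 A0
    using G0(1) M0(1) by unfold_locales (auto simp: admissible_def)
  have h: "card M0 \<ge> 1"
    using density_in_densities(2)[OF G0(1) M0(1,2)] .
  define m where "m = period div card M0"
  have "card M0 dvd fact (2 * Suc q)"
    using h M0(2) by (rule dvd_fact)
  then have m: "m * card M0 = period"
    unfolding m_def period_def by (intro dvd_div_mult_self dvd_mult)
  have "m \<ge> 2"
  proof -
    have "card M0 \<le> fact (2 * Suc q)"
      using \<open>card M0 dvd fact (2 * Suc q)\<close> by (intro dvd_imp_le) auto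
    then have "2 * card M0 \<le> m * card M0"
      unfolding m period_def by (rule mult_left_mono) simp
    then show ?thesis
      using h by simp
  qed
  have inj: "inj (to_nat :: nat \<times> nat \<Rightarrow> nat)"
    by simp
  define G where "G = (relabel to_nat (g0.pumped m) :: nat ugraph)"
  define M where "M = (to_nat ` (M0 \<times> {1..m}) :: nat set)"
  define A where "A = (to_nat ` (A0 \<times> {0::nat}) :: nat set)"
  have adm_pumped: "admissible Q (g0.pumped m)"
    by (rule g0.admissible_pumped[OF G0(1) small])
  have adm: "admissible Q G"
    unfolding G_def by (rule admissible_relabel[OF inj adm_pumped])
  have piece: "piece (adj G) (verts G) p M A"
    unfolding G_def M_def A_def using \<open>m \<ge> 2\<close> by (intro piece_relabel[OF inj] g0.piece_copies) auto
  have weight: "of_nat (weight (adj G) M A) = slope * of_nat period"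
    unfolding G_def M_def A_def weight_relabel[OF inj] m[symmetric] g0.weight_copies[OF le_add1]
    using M0(3) by simp
  have card_M: "card M = period"
    unfolding M_def m[symmetric] by (simp add: card_image inj_on_subset[OF inj] card_cartesian_product)
  have card_G: "card (verts G) = b + period"
    unfolding G_def card_verts_relabel[OF inj] g0.card_verts_pumped m G0(2) ..
  have arcs_G: "of_nat (arcs (adj G) (verts G)) = of_nat (2 * ex b) + slope * of_nat period"
  proof -
    have "arcs (adj G) (verts G) = 2 * ex b + m * weight (adj G0) M0 A0"
      unfolding G_def verts_relabel arcs_relabel[OF inj] g0.arcs_pumped
      by (simp add: arcs_eq_card_edges[OF g0.simple] G0(3))
    then show ?thesis
      using M0(3) by (simp flip: m)
  qed
  interpret g: graph_piece G p M A
    using adm piece by unfold_locales (auto simp: admissible_def)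
  have "\<not> connectivity_component (induced G M) G"
  proof (rule not_connectivity_component[OF g.simple g.piece])
    assume "A = {}"
    then have "A0 = {}"
      by (simp add: A_def)
    let ?S = "to_nat ` (M0 \<times> {1::nat}) :: nat set"
    have closed: "y \<in> M0 \<times> {1}"
      if "x \<in> M0 \<times> {1}" "y \<in> verts (g0.pumped m)" "adj (g0.pumped m) x y" for x y
    proof -
      have x: "x \<in> verts (g0.pumped m)"
        using that(1) by (auto simp: g0.verts_pumped)
      have "snd y \<noteq> 0"
      proof
        assume "snd y = 0"
        then have "adj (g0.pumped m) y x \<longleftrightarrow> fst y \<in> A0"
          using that(1) by (intro g0.adj_pumped_outside[OF that(2) x]) auto
        then show False
          using that(3) \<open>A0 = {}\<close> adj_commute[of "g0.pumped m" x y] by simp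
      qed
      then have "snd y = snd x" "fst y \<in> M0"
        using g0.adj_pumped[OF x that(2)] that g0.fst_mem_M[OF that(2)] by auto
      then show ?thesis
        using that(1) by (cases y) auto
    qed
    have "?S \<subseteq> M"
      unfolding M_def using \<open>m \<ge> 2\<close> by (intro image_mono) auto
    moreover have "?S \<noteq> {}"
      using g0.M(2) by simp
    moreover have "?S \<noteq> M"
    proof -
      obtain v where "v \<in> M0"
        using g0.M(2) by blast
      then have "(v, 2) \<in> M0 \<times> {1..m}" "(v, 2) \<notin> M0 \<times> {1::nat}"
        using \<open>m \<ge> 2\<close> by auto
      then have "M0 \<times> {1} \<noteq> M0 \<times> {1..m}"
        by metis
      then show ?thesis
        unfolding M_def using inj by (simp only: inj_image_eq_iff) simp
    qed
    moreover have "\<forall>x\<in>?S. \<forall>y\<in>verts G. adj G x y \<longrightarrow> y \<in> ?S"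
      unfolding G_def verts_relabel using closed by (auto simp: adj_relabel[OF inj])
    ultimately show "\<exists>S\<subseteq>M. S \<noteq> {} \<and> S \<noteq> M \<and> (\<forall>x\<in>S. \<forall>y\<in>verts G. adj G x y \<longrightarrow> y \<in> S)"
      by blast
  qed
  moreover have "of_nat (2 * ex n) = slope * of_nat n - deficit b \<and>
      (\<exists>k. admissible Q (g.pumped k) \<and> card (verts (g.pumped k)) = n \<and> card (edges (g.pumped k)) = ex n)"
    if n: "n \<ge> b + period" "n mod period = r" for n
  proof -
    define k where "k = (n - (b + period)) div period"
    have "(b + period) mod period = n mod period"
      using b(2) n(2) by simp
    then have "period dvd n - (b + period)"
      using n(1) mod_eq_dvd_iff_nat by metis
    then have n_eq: "n = b + period + k * period"
      using n(1) by (simp add: k_def)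
    have adm_k: "admissible Q (g.pumped k)"
      by (rule g.admissible_pumped[OF adm small])
    have card_k: "card (verts (g.pumped k)) = n"
      by (simp add: g.card_verts_pumped card_G card_M n_eq)
    have "2 * card (edges (g.pumped k)) = arcs (adj G) (verts G) + k * weight (adj G) M A"
      using g.arcs_pumped[of k] arcs_eq_card_edges[OF g.simple_graph_pumped] by simp
    then have "of_nat (2 * card (edges (g.pumped k))) =
        of_nat (2 * ex b) + slope * of_nat period + of_nat k * (slope * of_nat period)"
      using arcs_G weight by (simp del: mult_2 add: of_nat_add[symmetric])
    also have "\<dots> = slope * of_nat n - deficit b"
      by (simp add: n_eq deficit_def algebra_simps)
    finally have edges: "of_nat (2 * card (edges (g.pumped k))) = slope * of_nat n - deficit b" .
    have "card (edges (g.pumped k)) \<le> ex n"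
      using card_edges_le_ex[OF adm_k] card_k by simp
    moreover have "(of_nat (2 * ex n) :: rat) \<le> of_nat (2 * card (edges (g.pumped k)))"
      using edges b(3)[of n] n b(1) by (simp add: deficit_def)
    then have "ex n \<le> card (edges (g.pumped k))"
      by (simp only: of_nat_le_iff)
    ultimately have "card (edges (g.pumped k)) = ex n"
      by simp
    then show ?thesis
      using adm_k card_k edges by auto
  qed
  moreover have "deficit b \<ge> 0"
    using ex_le_slope[of b] by (simp add: deficit_def)
  ultimately show ?thesis
    using adm piece unfolding core_def by blast
qed

end

lemma profile_start:
  assumes "biclique_profile P" "start_index P = Suc p" "P (Suc p) = ereal (real q)"
  shows "\<And>j. j \<le> p \<Longrightarrow> P j = \<infinity>"
    and "\<And>j. ereal (real p) \<le> P j"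
    and "\<And>j. j > p \<Longrightarrow> \<exists>m\<le>q. P j = ereal (real m)"
    and "\<And>j. j > q \<Longrightarrow> P j = ereal (real p)"
proof -
  have P: "range P \<subseteq> range (\<lambda>m::nat. ereal (real m)) \<union> {\<infinity>, -\<infinity>}" "decseq P"
    "\<And>j l. P j < ereal (real l) \<Longrightarrow> P l < ereal (real j)"
    using assms(1) unfolding biclique_profile_def by blast+
  show inf: "P j = \<infinity>" if "j \<le> p" for j
  proof -
    have "j < (LEAST i. P i < \<infinity>)"
      using that assms(2) by (simp add: start_index_def)
    then have "\<not> P j < \<infinity>"
      by (rule not_less_Least)
    then show ?thesis
      by simp
  qed
  show ge: "ereal (real p) \<le> P j" for j
  proof (rule ccontr)
    assume "\<not> ereal (real p) \<le> P j"
    then have "P j < ereal (real p)"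
      by simp
    then have "P p < ereal (real j)"
      by (rule P(3))
    then show False
      using inf[of p] by simp
  qed
  show nat_value: "\<exists>m\<le>q. P j = ereal (real m)" if "j > p" for j
  proof -
    have "P j \<le> ereal (real q)"
      using decseqD[OF P(2), of "Suc p" j] that assms(3) by simp
    moreover have "P j \<in> range (\<lambda>m::nat. ereal (real m)) \<union> {\<infinity>, -\<infinity>}"
      using P(1) by blast
    ultimately show ?thesis
      using ge[of j] by auto
  qed
  show "P j = ereal (real p)" if "j > q" for j
  proof -
    have "P (Suc q) < ereal (real (Suc p))"
      by (rule P(3)) (simp add: assms(3))
    then have "P j < ereal (real (Suc p))"
      using decseqD[OF P(2), of "Suc q" j] that by (simp add: order_le_less_trans)
    moreover have "j > p"
      using inf[of j] calculation by (cases "j \<le> p") auto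
    then obtain m where "P j = ereal (real m)"
      using nat_value by blast
    ultimately show ?thesis
      using ge[of j] by simp
  qed
qed

lemma finite_profiles:
  "finite {P. biclique_profile P \<and> start_index P = Suc p \<and> P (Suc p) = ereal (real q)}"
proof (rule finite_subset)
  let ?V = "insert \<infinity> ((\<lambda>m. ereal (real m)) ` {..q})"
  show "{P. biclique_profile P \<and> start_index P = Suc p \<and> P (Suc p) = ereal (real q)} \<subseteq>
    {P. \<forall>j. (j \<in> {..q} \<longrightarrow> P j \<in> ?V) \<and> (j \<notin> {..q} \<longrightarrow> P j = ereal (real p))}"
  proof (intro subsetI CollectI allI conjI impI)
    fix P j
    assume "P \<in> {P. biclique_profile P \<and> start_index P = Suc p \<and> P (Suc p) = ereal (real q)}"
    then have P: "biclique_profile P" "start_index P = Suc p" "P (Suc p) = ereal (real q)"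
      by simp_all
    show "P j \<in> ?V"
      using profile_start(1,3)[OF P, of j] by (cases "j \<le> p") auto
    show "P j = ereal (real p)" if "j \<notin> {..q}"
      using profile_start(4)[OF P, of j] that by simp
  qed
  show "finite {P. \<forall>j. (j \<in> {..q} \<longrightarrow> P j \<in> ?V) \<and> (j \<notin> {..q} \<longrightarrow> P j = ereal (real p))}"
    by (rule finite_set_of_finite_funs) auto
qed

theorem theorem7:
  fixes s t :: nat
  assumes "s \<ge> 1" and "t \<ge> 1"
  shows "\<exists>N::nat. N \<ge> 1 \<and>
    (\<forall>P :: nat \<Rightarrow> ereal.
       biclique_profile P \<and> start_index P = s \<and> P s = ereal (real t - 1) \<and> lim P \<ge> 0 \<longrightarrow>
       (\<exists>(\<alpha>::rat) (R::nat) (G :: nat \<Rightarrow> nat ugraph) (H :: nat \<Rightarrow> nat ugraph) (a :: nat \<Rightarrow> rat).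
          \<alpha> \<ge> 0 \<and> R \<ge> 1 \<and>
          (\<forall>q<R. simple_graph (G q) \<and> card (verts (G q)) \<le> N \<and>
                 designated_component (H q) (G q) \<and> same_outer_nbhd (H q) (G q)) \<and>
          (\<forall>\<^sub>F n in sequentially. \<exists>k.
             extremal_cograph P (pump (G (n mod R)) (H (n mod R)) k) \<and>
             card (verts (pump (G (n mod R)) (H (n mod R)) k)) = n) \<and>
          (\<forall>q<R. a q \<le> 0) \<and>
          (\<forall>\<^sub>F n in sequentially. of_nat (ex_cograph n P) = a (n mod R) + \<alpha> * of_nat n) \<and>
          \<alpha> \<le> of_nat s - 1 + (of_nat t - 1) / 2 \<and>
          (s \<ge> 2 \<longrightarrow>
             (\<forall>n\<ge>1. (of_nat (ex_cograph n P) :: rat)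
                       < (of_nat s - 1 + (of_nat t - 1) / 2) * of_nat n)) \<and>
          ((\<exists>q<R. connectivity_component (H q) (G q)) \<longrightarrow>
             \<alpha> < of_nat s - 1 + (of_nat t - 1) / 2)))"
    (is "\<exists>N. N \<ge> 1 \<and> (\<forall>P. ?profile P \<longrightarrow> ?structure N P)")
proof -
  obtain p where s: "s = Suc p"
    using assms(1) by (cases s) auto
  obtain q where t: "t = Suc q"
    using assms(2) by (cases t) auto
  have bounded: "\<exists>N0. \<forall>N\<ge>N0. ?structure N P"
    if P: "biclique_profile P" "start_index P = Suc p" "P (Suc p) = ereal (real q)" for P
  proof -
    interpret biclique_class "\<lambda>j l. ereal (real l) \<le> P j" p q
    proof
      show "ereal (real l) \<le> P j" if "j \<le> p \<or> l \<le> p" for j l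
        using that
      proof
        assume "l \<le> p"
        then have "ereal (real l) \<le> ereal (real p)"
          by simp
        then show ?thesis
          using profile_start(2)[OF P] by (rule order_trans)
      qed (simp add: profile_start(1)[OF P])
      show "\<not> ereal (real (Suc q)) \<le> P (Suc p)"
        using P(3) by simp
    qed
    have ex_cograph: "ex_cograph n P = ex n" for n
      unfolding ex_cograph_def ex_def cograph_fulfills_iff[symmetric] conj_assoc ..
    have extremal: "extremal_cograph P G"
      if "admissible (\<lambda>j l. ereal (real l) \<le> P j) G" "card (edges G) = ex (card (verts G))"
      for G :: "(nat \<times> nat) ugraph"
      unfolding extremal_cograph_def
    proof (intro conjI allI impI)
      show "cograph G" "fulfills G P"
        using that(1) cograph_fulfills_iff by blast+
      fix G' :: "nat ugraph"
      assume "cograph G' \<and> fulfills G' P \<and> card (verts G') = card (verts G)"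
      then show "card (edges G') \<le> card (edges G)"
        using card_edges_le_ex[of G'] that(2) cograph_fulfills_iff[of G' P] by simp
    qed
    obtain G M A d n0 where core: "\<And>r. r < period \<Longrightarrow> core r (G r) (M r) (A r) (d r) (n0 r)"
      using core_of_residue by metis
    define N0 where "N0 = (\<Sum>r<period. card (verts (G r)))"
    define n1 where "n1 = (\<Sum>r<period. n0 r)"
    have card_G: "card (verts (G r)) \<le> N0" if "r < period" for r
      unfolding N0_def using that by (intro member_le_sum) auto
    have period: "period \<ge> 1"
      by (simp add: period_def Suc_le_eq)
    have large_n: "of_nat (2 * ex n) = slope * of_nat n - d (n mod period)"
      "\<exists>k. admissible (\<lambda>j l. ereal (real l) \<le> P j)
          (pump (G (n mod period)) (induced (G (n mod period)) (M (n mod period))) k) \<and>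
        card (verts (pump (G (n mod period)) (induced (G (n mod period)) (M (n mod period))) k)) = n \<and>
        card (edges (pump (G (n mod period)) (induced (G (n mod period)) (M (n mod period))) k)) = ex n"
      if "n \<ge> n1" for n
    proof -
      have r: "n mod period < period"
        using period by simp
      then have "n0 (n mod period) \<le> n1"
        unfolding n1_def by (intro member_le_sum) auto
      then have "n0 (n mod period) \<le> n"
        using that by simp
      then show "of_nat (2 * ex n) = slope * of_nat n - d (n mod period)"
        "\<exists>k. admissible (\<lambda>j l. ereal (real l) \<le> P j)
            (pump (G (n mod period)) (induced (G (n mod period)) (M (n mod period))) k) \<and>
          card (verts (pump (G (n mod period)) (induced (G (n mod period)) (M (n mod period))) k)) = n \<and>
          card (edges (pump (G (n mod period)) (induced (G (n mod period)) (M (n mod period))) k)) = ex n"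
        using core[OF r] unfolding core_def by blast+
    qed
    have bound: "of_nat s - 1 + (of_nat t - 1) / 2 = (of_nat (2 * p + q) / 2 :: rat)"
      by (simp add: s t field_simps)
    have "?structure N P" if "N \<ge> N0" for N
    proof (rule exI[of _ "slope / 2"], rule exI[of _ period], rule exI[of _ G],
        rule exI[of _ "\<lambda>r. induced (G r) (M r)"], rule exI[of _ "\<lambda>r. - d r / 2"],
        intro conjI allI impI)
      show "0 \<le> slope / 2"
        using order_trans[OF _ slope_ge] by simp
      show "1 \<le> period"
        by (rule period)
      fix r assume r: "r < period"
      have G: "simple_graph (G r)" "piece (adj (G r)) (verts (G r)) p (M r) (A r)"
        using core[OF r] by (simp_all add: core_def admissible_def)
      show "simple_graph (G r)"
        by (rule G(1))
      show "card (verts (G r)) \<le> N"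
        using card_G[OF r] that by simp
      show "designated_component (induced (G r) (M r)) (G r)" "same_outer_nbhd (induced (G r) (M r)) (G r)"
        by (rule piece_designated_component[OF G])+
      show "- d r / 2 \<le> 0"
        using core[OF r] by (simp add: core_def)
    next
      show "\<forall>\<^sub>F n in sequentially. \<exists>k.
             extremal_cograph P (pump (G (n mod period)) (induced (G (n mod period)) (M (n mod period))) k) \<and>
             card (verts (pump (G (n mod period)) (induced (G (n mod period)) (M (n mod period))) k)) = n"
        unfolding eventually_sequentially
      proof (rule exI[of _ n1], intro allI impI)
        fix n assume "n1 \<le> n"
        then show "\<exists>k. extremal_cograph P (pump (G (n mod period)) (induced (G (n mod period)) (M (n mod period))) k) \<and>
             card (verts (pump (G (n mod period)) (induced (G (n mod period)) (M (n mod period))) k)) = n"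
          using large_n(2)[of n] extremal by metis
      qed
      show "\<forall>\<^sub>F n in sequentially.
          of_nat (ex_cograph n P) = - d (n mod period) / 2 + slope / 2 * of_nat n"
        unfolding eventually_sequentially
      proof (rule exI[of _ n1], intro allI impI)
        fix n assume "n1 \<le> n"
        then show "of_nat (ex_cograph n P) = - d (n mod period) / 2 + slope / 2 * of_nat n"
          using large_n(1)[of n] unfolding ex_cograph by simp
      qed
      show "slope / 2 \<le> of_nat s - 1 + (of_nat t - 1) / 2"
        unfolding bound using slope_le by (simp add: divide_right_mono)
    next
      fix n :: nat assume "2 \<le> s" "1 \<le> n"
      then have "(of_nat (2 * ex n) :: rat) < of_nat ((2 * p + q) * n)"
        using ex_less s by (intro iffD2[OF of_nat_less_iff]) simp
      then show "of_nat (ex_cograph n P) < (of_nat s - 1 + (of_nat t - 1) / 2 :: rat) * of_nat n"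
        unfolding bound ex_cograph by simp
    next
      assume "\<exists>r<period. connectivity_component (induced (G r) (M r)) (G r)"
      then show "slope / 2 < of_nat s - 1 + (of_nat t - 1) / 2"
        using core by (auto simp: core_def)
    qed
    then show ?thesis
      by blast
  qed
  let ?profiles = "{P. biclique_profile P \<and> start_index P = Suc p \<and> P (Suc p) = ereal (real q)}"
  have "\<forall>P\<in>?profiles. \<exists>N0. \<forall>N\<ge>N0. ?structure N P"
    using bounded by blast
  then obtain f where f: "\<forall>P\<in>?profiles. \<forall>N\<ge>f P. ?structure N P"
    by (rule bchoice[THEN exE])
  show ?thesis
  proof (intro exI[of _ "Suc (\<Sum>P\<in>?profiles. f P)"] conjI allI impI)
    fix P
    assume "?profile P"
    then have P: "P \<in> ?profiles"
      by (simp add: s t)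
    have "f P \<le> (\<Sum>P\<in>?profiles. f P)"
      by (rule member_le_sum[OF P _ finite_profiles]) simp
    then show "?structure (Suc (\<Sum>P\<in>?profiles. f P)) P"
      using f P by (intro f[rule_format]) simp_all
  qed simp
qed

end
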